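(* Assume that $n\ge 3$. Then $$\mathrm{Aut}(\mathcal{X}_0)=(\mathrm{GL}(2,q)_K\rtimes\Sigma_0)^{\Omega}\qquad\text{and}\qquad \mathrm{Iso}(\mathcal{X}_0)=\mathrm{\Gamma L}(2,q)^{\Omega}.$$
   Context: Setting. Let $r$ be a prime, $d\ge1$, $q=r^d$, $\mathbb{F}$ the field of order $q$, and $n\ge 1$ a divisor of $q-1$ such that $q(q-1)/n$ is even. Let $K$ be the subgroup of index $n$ in $\mathbb{F}^*$ and $C=\mathbb{F}^*/K$, a cyclic group of order $n$ with identity element $e$. Let $V$ be the space of column vectors $\mathbb{F}^2$ and $\Omega=\{Kv: v\in V\setminus\{0\}\}$, where $Kv=\{xv:x\in K\}$. For $g=Ky\in C$ and $\alpha=Kv\in\Omega$ put $g\alpha=K(yv)\in\Omega$. Define $\langle\cdot,\cdot\rangle:\Omega\times\Omega\to C\cup\{0\}$ by $\langle Ku,Kv\rangle=K\det(u,v)$, where $\det(u,v)=u_1v_2-u_2v_1$ (read as $0$ if $\det(u,v)=0$); this is well defined and symmetric since $-1\in K$. For $g\in C$ put $$r_g=\{(\alpha,\beta)\in\Omega^2: \beta=g\alpha\},\qquad s_g=\{(\alpha,\beta)\in\Omega^2:\langle\alpha,\beta\rangle=g\}.$$ The pair $\mathcal{X}_0=(\Omega,S_0)$ with $S_0=\{r_g,s_g:g\in C\}$ is known to be an association scheme (a Tatra scheme); it is noncommutative if and only if $n\ge3$. For $f\in\mathrm{Sym}(\Omega)$ and $s\subseteq\Omega^2$ put $s^f=\{(\alpha^f,\beta^f):(\alpha,\beta)\in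 s\}$. Then $\mathrm{Iso}(\mathcal{X}_0)=\{f\in\mathrm{Sym}(\Omega): \{s^f:s\in S_0\}=S_0\}$ and $\mathrm{Aut}(\mathcal{X}_0)=\{f\in\mathrm{Sym}(\Omega): s^f=s \text{ for every } s\in S_0\}$. Groups. $\Sigma=\mathrm{Aut}(\mathbb{F})$ is the Galois group (cyclic of order $d$, generated by $x\mapsto x^r$), $\mathrm{\Gamma L}(2,q)=\mathrm{GL}(2,q)\rtimes\Sigma$. An element $T\sigma$ ($T\in\mathrm{GL}(2,q)$, $\sigma\in\Sigma$) induces on $\Omega$ the permutation $Kv\mapsto K(Tv^{\sigma})$, where $\sigma$ acts on the components of $v$. For a subgroup $H\le \mathrm{\Gamma L}(2,q)$, $H^{\Omega}$ denotes the permutation group induced by $H$ on $\Omega$. Put $\mathrm{GL}(2,q)_K=\{T\in\mathrm{GL}(2,q):\det(T)\in K\}$. $\Sigma$ acts on $C$ by $(Kx)^\sigma=K(x^\sigma)$, and $\Sigma_0$ is the kernel of this action. *)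

theory Defs
  imports
    "HOL-Analysis.Analysis"
    "HOL-Algebra.Algebra"
    "HOL-Algebra.Algebraic_Closure_Type"
begin

hide_const (open) Ring_Divisibility.mult_of Divisibility.prime

text \<open>The field \<open>\<F>\<close> is the type \<^typ>\<open>'a\<close>, of sort field and finite; the group \<open>\<F>\<^sup>*\<close>, its subgroup \<open>K\<close>
  and the quotient \<open>C\<close> (\<open>class_group\<close>) are taken from HOL-Algebra.\<close>

abbreviation FF :: "'a::field ring" where
  "FF \<equiv> ring_of_type_algebra"

abbreviation units_group :: "'a::field monoid" where
  "units_group \<equiv> Multiplicative_Group.mult_of FF"

definition class_group :: "'a::field set \<Rightarrow> 'a set monoid" where
  "class_group K = units_group Mod K"

definition orb :: "'a::field set \<Rightarrow> 'a^2 \<Rightarrow> ('a^2) set" where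
  "orb K v = (\<lambda>x. x *s v) ` K"

definition \<Omega> :: "'a::field set \<Rightarrow> ('a^2) set set" where
  "\<Omega> K = {orb K v | v. v \<noteq> 0}"

text \<open>Functions on classes are defined by taking the union over all representatives; that
  this agrees with the defining formula on any single representative is proved below
  (\<open>cact_eq\<close>, \<open>pairing_eq\<close>, \<open>galois_C_eq\<close>, \<open>gl_action_eq\<close>).\<close>

definition cact :: "'a::field set \<Rightarrow> 'a set \<Rightarrow> ('a^2) set \<Rightarrow> ('a^2) set" where
  "cact K g \<alpha> = (\<Union>y\<in>g. \<Union>v\<in>\<alpha>. orb K (y *s v))"

definition det2 :: "'a::field^2 \<Rightarrow> 'a^2 \<Rightarrow> 'a" where
  "det2 u v = u$1 * v$2 - u$2 * v$1"

text \<open>The additional value \<open>0\<close> of the pairing is represented by \<open>K0 = {0}\<close>, which is not an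
  element of \<open>C\<close>.\<close>

definition pairing :: "'a::field set \<Rightarrow> ('a^2) set \<Rightarrow> ('a^2) set \<Rightarrow> 'a set" where
  "pairing K \<alpha> \<beta> = (\<Union>u\<in>\<alpha>. \<Union>v\<in>\<beta>. K #>\<^bsub>units_group\<^esub> det2 u v)"

definition rel_r :: "'a::field set \<Rightarrow> 'a set \<Rightarrow> (('a^2) set \<times> ('a^2) set) set" where
  "rel_r K g = {(\<alpha>, \<beta>) \<in> \<Omega> K \<times> \<Omega> K. \<beta> = cact K g \<alpha>}"

definition rel_s :: "'a::field set \<Rightarrow> 'a set \<Rightarrow> (('a^2) set \<times> ('a^2) set) set" where
  "rel_s K g = {(\<alpha>, \<beta>) \<in> \<Omega> K \<times> \<Omega> K. pairing K \<alpha> \<beta> = g}"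

definition S0 :: "'a::field set \<Rightarrow> (('a^2) set \<times> ('a^2) set) set set" where
  "S0 K = rel_r K ` carrier (class_group K) \<union> rel_s K ` carrier (class_group K)"

text \<open>Isomorphisms and automorphisms of a set \<open>S\<close> of binary relations on \<open>A\<close>.
  Permutations of \<open>A\<close> are those of \<^const>\<open>BijGroup\<close>, i.e. extensional functions.\<close>

definition rel_image :: "('b \<Rightarrow> 'b) \<Rightarrow> ('b \<times> 'b) set \<Rightarrow> ('b \<times> 'b) set" where
  "rel_image f s = {(f \<alpha>, f \<beta>) | \<alpha> \<beta>. (\<alpha>, \<beta>) \<in> s}"

definition Iso :: "'b set \<Rightarrow> ('b \<times> 'b) set set \<Rightarrow> ('b \<Rightarrow> 'b) set" where
  "Iso A S = {f \<in> carrier (BijGroup A). {rel_image f s | s. s \<in> S} = S}"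

definition Aut :: "'b set \<Rightarrow> ('b \<times> 'b) set set \<Rightarrow> ('b \<Rightarrow> 'b) set" where
  "Aut A S = {f \<in> carrier (BijGroup A). \<forall>s\<in>S. rel_image f s = s}"

definition semidirect :: "'x monoid \<Rightarrow> 'y monoid \<Rightarrow> ('y \<Rightarrow> 'x \<Rightarrow> 'x) \<Rightarrow> ('x \<times> 'y) monoid" where
  "semidirect N H \<phi> =
    \<lparr>carrier = carrier N \<times> carrier H,
     mult = (\<lambda>(a, s) (b, t). (a \<otimes>\<^bsub>N\<^esub> \<phi> s b, s \<otimes>\<^bsub>H\<^esub> t)),
     one = (\<one>\<^bsub>N\<^esub>, \<one>\<^bsub>H\<^esub>)\<rparr>"

definition GL2 :: "('a::field^2^2) monoid" where
  "GL2 = \<lparr>carrier = {T. invertible T}, mult = (**), one = mat 1\<rparr>"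

definition GL2_K :: "'a::field set \<Rightarrow> ('a^2^2) monoid" where
  "GL2_K K = GL2\<lparr>carrier := {T \<in> carrier GL2. det T \<in> K}\<rparr>"

definition Galois :: "('a::field \<Rightarrow> 'a) monoid" where
  "Galois = \<lparr>carrier = ring_iso FF FF, mult = (\<circ>), one = id\<rparr>"

definition galois_vec :: "('a::field \<Rightarrow> 'a) \<Rightarrow> 'a^2 \<Rightarrow> 'a^2" where
  "galois_vec \<sigma> v = (\<chi> i. \<sigma> (v $ i))"

definition galois_mat :: "('a::field \<Rightarrow> 'a) \<Rightarrow> 'a^2^2 \<Rightarrow> 'a^2^2" where
  "galois_mat \<sigma> T = (\<chi> i j. \<sigma> (T $ i $ j))"

definition galois_C :: "'a::field set \<Rightarrow> ('a \<Rightarrow> 'a) \<Rightarrow> 'a set \<Rightarrow> 'a set" where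
  "galois_C K \<sigma> = (\<lambda>c\<in>carrier (class_group K). \<Union>x\<in>c. K #>\<^bsub>units_group\<^esub> \<sigma> x)"

definition Galois0 :: "'a::field set \<Rightarrow> ('a \<Rightarrow> 'a) monoid" where
  "Galois0 K = Galois\<lparr>carrier := kernel Galois (BijGroup (carrier (class_group K))) (galois_C K)\<rparr>"

definition GammaL2 :: "(('a::field^2^2) \<times> ('a \<Rightarrow> 'a)) monoid" where
  "GammaL2 = semidirect GL2 Galois galois_mat"

definition GL2_K_Galois0 :: "'a::field set \<Rightarrow> (('a^2^2) \<times> ('a \<Rightarrow> 'a)) monoid" where
  "GL2_K_Galois0 K = semidirect (GL2_K K) (Galois0 K) galois_mat"

definition gl_action ::
  "'a::field set \<Rightarrow> ('a^2^2) \<times> ('a \<Rightarrow> 'a) \<Rightarrow> ('a^2) set \<Rightarrow> ('a^2) set" where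
  "gl_action K = (\<lambda>(T, \<sigma>). \<lambda>\<alpha>\<in>\<Omega> K. \<Union>v\<in>\<alpha>. orb K (T *v galois_vec \<sigma> v))"

definition induced ::
  "'a::field set \<Rightarrow> (('a^2^2) \<times> ('a \<Rightarrow> 'a)) monoid \<Rightarrow> (('a^2) set \<Rightarrow> ('a^2) set) set" where
  "induced K H = gl_action K ` carrier H"

subsection \<open>Well-definedness\<close>

lemma FF_simps [simp]:
  "carrier (FF :: 'a::field ring) = UNIV" "mult (FF :: 'a ring) = (*)"
  "\<one>\<^bsub>(FF :: 'a ring)\<^esub> = 1" "\<zero>\<^bsub>(FF :: 'a ring)\<^esub> = 0" "add (FF :: 'a ring) = (+)"
  by (simp_all add: ring_of_type_algebra_def)

lemma group_units_group: "group (units_group :: 'a::field monoid)"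
  using field.field_mult_group[OF field_from_type_algebra] .

lemma Galois_iff:
  "\<sigma> \<in> carrier (Galois :: ('a::field \<Rightarrow> 'a) monoid) \<longleftrightarrow>
    bij \<sigma> \<and> \<sigma> 1 = 1 \<and> (\<forall>x y. \<sigma> (x + y) = \<sigma> x + \<sigma> y) \<and> (\<forall>x y. \<sigma> (x * y) = \<sigma> x * \<sigma> y)"
  by (auto simp: Galois_def ring_iso_def ring_hom_def)

lemma Galois_0:
  assumes "\<sigma> \<in> carrier (Galois :: ('a::field \<Rightarrow> 'a) monoid)" shows "\<sigma> 0 = 0"
proof -
  have "\<sigma> (0 + 0) = \<sigma> 0 + \<sigma> 0" using assms unfolding Galois_iff by blast
  then show ?thesis by (metis add_cancel_right_right add_0)
qed

lemma Galois_power: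
  assumes "\<sigma> \<in> carrier (Galois :: ('a::field \<Rightarrow> 'a) monoid)" shows "\<sigma> (x ^ k) = \<sigma> x ^ k"
  using assms by (induction k) (auto simp: Galois_iff)

lemma r_coset_K: "K #>\<^bsub>units_group\<^esub> (x::'a::field) = (\<lambda>y. y * x) ` K"
  by (auto simp: r_coset_def)

context
  fixes K :: "'a::{field,finite} set"
  assumes K: "subgroup K units_group"
begin

lemma K_nz: "x \<in> K \<Longrightarrow> x \<noteq> 0"
  using subgroup.subset[OF K] by auto

lemma K_one: "1 \<in> K"
  using subgroup.one_closed[OF K] by simp

lemma K_mult: "x \<in> K \<Longrightarrow> y \<in> K \<Longrightarrow> x * y \<in> K"
  using subgroup.m_closed[OF K] by simp

lemma K_absorb: 
  assumes "x \<in> K" shows "(\<lambda>y. y * x) ` K = K"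
proof -
  interpret group "units_group :: 'a monoid" by (rule group_units_group)
  have "K #>\<^bsub>units_group\<^esub> x = K" 
    using coset_join2[OF _ K assms] assms K_nz by simp
  then show ?thesis by (simp add: r_coset_K)
qed

lemma coset_absorb: "x \<in> K \<Longrightarrow> K #>\<^bsub>units_group\<^esub> (x * y) = K #>\<^bsub>units_group\<^esub> y"
  using arg_cong[OF K_absorb, of x "\<lambda>A. (\<lambda>z. z * y) ` A"]
  by (simp add: r_coset_K image_image mult.assoc)

lemma orb_absorb: "x \<in> K \<Longrightarrow> orb K (x *s y) = orb K y"
  using arg_cong[OF K_absorb, of x "\<lambda>A. (\<lambda>z. z *s y) ` A"]
  by (simp add: orb_def image_image vector_smult_assoc)

lemma K_roots: "K = {x. x ^ card K = 1}"
proof -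
  let ?m = "card K" and ?p = "Polynomial.monom 1 (card K) - 1 :: 'a poly"
  interpret group "units_group :: 'a monoid" by (rule group_units_group)
  have m: "?m > 0" using K_one by (auto simp: card_gt_0_iff)
  have deg: "Polynomial.degree ?p \<le> ?m"
    by (intro degree_diff_le degree_monom_le) simp
  have "poly.coeff ?p ?m = 1" using m by (auto simp: card_gt_0_iff)
  then have p0: "?p \<noteq> 0" by (metis coeff_0 zero_neq_one)
  have sub: "K \<subseteq> {x. x ^ ?m = 1}"
  proof
    fix x assume x: "x \<in> K"
    have "(\<Prod>y\<in>K. y) = (\<Prod>y\<in>(\<lambda>y. y * x) ` K. y)" using K_absorb[OF x] by simp
    also have "\<dots> = (\<Prod>y\<in>K. y * x)"
      using K_nz[OF x] by (subst prod.reindex) (auto simp: inj_on_def)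
    also have "\<dots> = (\<Prod>y\<in>K. y) * x ^ ?m" by (simp add: prod.distrib)
    finally show "x \<in> {x. x ^ ?m = 1}" using K_nz by (simp add: prod_zero_iff)
  qed
  have "{x::'a. x ^ ?m = 1} = {x. poly ?p x = 0}" by (simp add: poly_monom)
  then have "card {x::'a. x ^ ?m = 1} = card {x. poly ?p x = 0}" by (rule arg_cong)
  also have "\<dots> \<le> Polynomial.degree ?p" by (rule card_poly_roots_bound[OF p0])
  also have "\<dots> \<le> ?m" by (rule deg)
  finally have "card {x::'a. x ^ ?m = 1} \<le> ?m" .
  then show ?thesis using sub by (intro card_seteq) auto
qed

lemma Galois_K: "\<sigma> \<in> carrier Galois \<Longrightarrow> x \<in> K \<Longrightarrow> \<sigma> x \<in> K"
proof -
  assume s: "\<sigma> \<in> carrier Galois" and "x \<in> K"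
  then have "x ^ card K = 1" using K_roots by blast
  then have "\<sigma> x ^ card K = 1" using s by (metis Galois_power Galois_iff)
  then show ?thesis using K_roots by blast
qed

lemma cact_eq: "cact K (K #>\<^bsub>units_group\<^esub> y) (orb K v) = orb K (y *s v)"
proof -
  have "orb K ((a * y) *s (b *s v)) = orb K (y *s v)" if "a \<in> K" "b \<in> K" for a b
    using orb_absorb[OF K_mult[OF that], of "y *s v"]
    by (simp add: vector_smult_assoc ac_simps)
  then show ?thesis using K_one by (auto simp: cact_def r_coset_K orb_def[of K v])
qed

lemma det2_scale: "det2 (a *s u) (b *s v) = (a * b) * det2 u v"
  by (simp add: det2_def algebra_simps)

lemma pairing_eq: "pairing K (orb K u) (orb K v) = K #>\<^bsub>units_group\<^esub> det2 u v"
  using K_one by (auto simp: pairing_def orb_def det2_scale coset_absorb K_mult)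

lemma zero_notin_class_group: "{0} \<notin> carrier (class_group K)"
  using K_one K_nz by (auto simp: class_group_def FactGroup_def RCOSETS_def r_coset_K)

lemma galois_C_eq:
  assumes "\<sigma> \<in> carrier Galois" "x \<noteq> 0"
  shows "galois_C K \<sigma> (K #>\<^bsub>units_group\<^esub> x) = K #>\<^bsub>units_group\<^esub> \<sigma> x"
proof -
  have "K #>\<^bsub>units_group\<^esub> x \<in> carrier (class_group K)"
    using assms by (auto simp: class_group_def FactGroup_def RCOSETS_def)
  moreover have "K #>\<^bsub>units_group\<^esub> \<sigma> (a * x) = K #>\<^bsub>units_group\<^esub> \<sigma> x" if "a \<in> K" for a
    using coset_absorb[OF Galois_K[OF assms(1) that]] assms(1) by (simp add: Galois_iff)
  ultimately show ?thesis
    using K_one by (auto simp: galois_C_def r_coset_K[of K x])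
qed

lemma gl_action_eq:
  assumes "\<sigma> \<in> carrier Galois" "v \<noteq> 0"
  shows "gl_action K (T, \<sigma>) (orb K v) = orb K (T *v galois_vec \<sigma> v)"
proof -
  have "orb K v \<in> \<Omega> K" using assms by (auto simp: \<Omega>_def)
  moreover have "orb K (T *v galois_vec \<sigma> (a *s v)) = orb K (T *v galois_vec \<sigma> v)"
    if "a \<in> K" for a
  proof -
    have "galois_vec \<sigma> (a *s v) = \<sigma> a *s galois_vec \<sigma> v"
      using assms(1) by (simp add: galois_vec_def vec_eq_iff Galois_iff)
    then show ?thesis
      using orb_absorb[OF Galois_K[OF assms(1) that]] by (simp add: vector_scalar_commute)
  qed
  ultimately show ?thesis
    using K_one by (auto simp: gl_action_def orb_def[of K v])
qed

end

subsection \<open>The groups and their action\<close>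

lemma group_GL2: "group (GL2 :: ('a::field^2^2) monoid)"
proof (rule groupI)
  fix T :: "'a^2^2" assume "T \<in> carrier GL2"
  then show "\<exists>S\<in>carrier GL2. S \<otimes>\<^bsub>GL2\<^esub> T = \<one>\<^bsub>GL2\<^esub>"
    by (auto simp: GL2_def invertible_def)
qed (auto simp: GL2_def invertible_mult matrix_mul_assoc invertible_def[of "mat 1"])

lemma group_Galois: "group (Galois :: ('a::field \<Rightarrow> 'a) monoid)"
proof (rule groupI)
  fix \<sigma> :: "'a \<Rightarrow> 'a" assume s: "\<sigma> \<in> carrier Galois"
  then have b: "bij \<sigma>" by (simp add: Galois_iff)
  have "inv_into UNIV \<sigma> \<in> carrier Galois"
    unfolding Galois_iff
    using s bij_imp_bij_inv[OF b] bij_inv_eq_iff[OF b]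
    by (metis Galois_iff)
  moreover have "inv_into UNIV \<sigma> \<circ> \<sigma> = id" using b by (simp add: bij_def)
  ultimately show "\<exists>\<tau>\<in>carrier Galois. \<tau> \<otimes>\<^bsub>Galois\<^esub> \<sigma> = \<one>\<^bsub>Galois\<^esub>"
    by (auto simp: Galois_def)
next
  fix \<sigma> \<tau> :: "'a \<Rightarrow> 'a" assume "\<sigma> \<in> carrier Galois" "\<tau> \<in> carrier Galois"
  then show "\<sigma> \<otimes>\<^bsub>Galois\<^esub> \<tau> \<in> carrier Galois"
    unfolding Galois_iff by (simp add: Galois_def bij_comp)
next
  show "\<one>\<^bsub>Galois\<^esub> \<in> carrier (Galois :: ('a \<Rightarrow> 'a) monoid)"
    unfolding Galois_iff by (simp add: Galois_def)
qed (auto simp: Galois_def)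

lemma galois_mat_mult:
  "\<sigma> \<in> carrier Galois \<Longrightarrow> galois_mat \<sigma> (S ** T) = galois_mat \<sigma> S ** galois_mat \<sigma> T"
  by (simp add: galois_mat_def matrix_matrix_mult_def vec_eq_iff sum_2 Galois_iff)

lemma galois_mat_vec:
  "\<sigma> \<in> carrier Galois \<Longrightarrow> galois_vec \<sigma> (T *v v) = galois_mat \<sigma> T *v galois_vec \<sigma> v"
  by (simp add: galois_mat_def galois_vec_def matrix_vector_mult_def vec_eq_iff sum_2 Galois_iff)

lemma galois_mat_one: "\<sigma> \<in> carrier Galois \<Longrightarrow> galois_mat \<sigma> (mat 1) = mat 1"
  using Galois_0[of \<sigma>] by (simp add: galois_mat_def mat_def vec_eq_iff Galois_iff)

lemma galois_mat_GL2:
  assumes "\<sigma> \<in> carrier Galois" "T \<in> carrier GL2" shows "galois_mat \<sigma> T \<in> carrier GL2"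
proof -
  obtain S where "S ** T = mat 1" "T ** S = mat 1"
    using assms by (auto simp: GL2_def invertible_def)
  then have "galois_mat \<sigma> S ** galois_mat \<sigma> T = mat 1" "galois_mat \<sigma> T ** galois_mat \<sigma> S = mat 1"
    using assms(1) by (simp_all flip: galois_mat_mult add: galois_mat_one)
  then show ?thesis by (auto simp: GL2_def invertible_def)
qed

lemma galois_mat_comp: "galois_mat (\<sigma> \<circ> \<tau>) T = galois_mat \<sigma> (galois_mat \<tau> T)"
  by (simp add: galois_mat_def)

lemma group_GammaL2: "group (GammaL2 :: (('a::field^2^2) \<times> ('a \<Rightarrow> 'a)) monoid)"
proof -
  interpret N: group "GL2 :: ('a^2^2) monoid" by (rule group_GL2)
  interpret H: group "Galois :: ('a \<Rightarrow> 'a) monoid" by (rule group_Galois)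
  have gal: "\<sigma> \<otimes>\<^bsub>Galois\<^esub> \<tau> = \<sigma> \<circ> \<tau>" "\<one>\<^bsub>Galois\<^esub> = id"
    "S \<otimes>\<^bsub>GL2\<^esub> T = S ** T" "\<one>\<^bsub>GL2\<^esub> = mat 1" for \<sigma> \<tau> :: "'a \<Rightarrow> 'a" and S T :: "'a^2^2"
    by (simp_all add: Galois_def GL2_def)
  have gid: "galois_mat id T = T" for T :: "'a^2^2" by (simp add: galois_mat_def)
  show ?thesis
  proof (rule groupI)
    fix x :: "('a^2^2) \<times> ('a \<Rightarrow> 'a)" assume x: "x \<in> carrier GammaL2"
    obtain T \<sigma> where Ts: "x = (T, \<sigma>)" "T \<in> carrier GL2" "\<sigma> \<in> carrier Galois"
      using x by (auto simp: GammaL2_def semidirect_def)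
    let ?t = "inv\<^bsub>Galois\<^esub> \<sigma>"
    let ?S = "galois_mat ?t (inv\<^bsub>GL2\<^esub> T)"
    have t: "?t \<in> carrier Galois" using Ts by simp
    have "?S ** galois_mat ?t T = mat 1"
      using N.l_inv[OF Ts(2)] t by (simp add: gal galois_mat_one flip: galois_mat_mult)
    moreover have "?S \<in> carrier GL2" using Ts t by (simp add: galois_mat_GL2)
    moreover have "?t \<circ> \<sigma> = id" using H.l_inv[OF Ts(3)] by (simp add: gal)
    ultimately have "(?S, ?t) \<in> carrier GammaL2 \<and> (?S, ?t) \<otimes>\<^bsub>GammaL2\<^esub> x = \<one>\<^bsub>GammaL2\<^esub>"
      using t by (simp add: GammaL2_def semidirect_def Ts gal)
    then show "\<exists>y\<in>carrier GammaL2. y \<otimes>\<^bsub>GammaL2\<^esub> x = \<one>\<^bsub>GammaL2\<^esub>" by blast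
  next
    fix x y z :: "('a^2^2) \<times> ('a \<Rightarrow> 'a)"
    assume "x \<in> carrier GammaL2" "y \<in> carrier GammaL2" "z \<in> carrier GammaL2"
    then show "x \<otimes>\<^bsub>GammaL2\<^esub> y \<otimes>\<^bsub>GammaL2\<^esub> z = x \<otimes>\<^bsub>GammaL2\<^esub> (y \<otimes>\<^bsub>GammaL2\<^esub> z)"
      by (auto simp: GammaL2_def semidirect_def gal galois_mat_mult galois_mat_comp
          matrix_mul_assoc o_assoc)
  next
    fix x y :: "('a^2^2) \<times> ('a \<Rightarrow> 'a)"
    assume "x \<in> carrier GammaL2" "y \<in> carrier GammaL2"
    then show "x \<otimes>\<^bsub>GammaL2\<^esub> y \<in> carrier GammaL2"
      by (auto simp: GammaL2_def semidirect_def galois_mat_GL2)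
  next
    show "\<one>\<^bsub>GammaL2\<^esub> \<in> carrier (GammaL2 :: (('a^2^2) \<times> ('a \<Rightarrow> 'a)) monoid)"
      using N.one_closed H.one_closed by (simp add: GammaL2_def semidirect_def)
  qed (auto simp: GammaL2_def semidirect_def gal gid)
qed

lemma galois_vec_nz:
  assumes "\<sigma> \<in> carrier Galois" "v \<noteq> 0" shows "galois_vec \<sigma> v \<noteq> 0"
proof
  assume "galois_vec \<sigma> v = 0"
  then have "\<sigma> (v $ i) = \<sigma> 0" for i
    using Galois_0[OF assms(1)] by (simp add: galois_vec_def vec_eq_iff)
  then have "v $ i = 0" for i
    using assms(1) unfolding Galois_iff bij_def by (meson injD)
  then show False using assms(2) by (simp add: vec_eq_iff)
qed

lemma semilinear_nz:
  assumes "T \<in> carrier GL2" "\<sigma> \<in> carrier Galois" "v \<noteq> (0::'a::field^2)"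
  shows "T *v galois_vec \<sigma> v \<noteq> 0"
proof
  obtain S where S: "S ** T = mat 1" using assms by (auto simp: GL2_def invertible_def)
  assume "T *v galois_vec \<sigma> v = 0"
  then have "S *v (T *v galois_vec \<sigma> v) = 0" by simp
  then have "galois_vec \<sigma> v = 0" by (simp add: matrix_vector_mul_assoc S)
  then show False using galois_vec_nz[OF assms(2,3)] by simp
qed

lemma gl_action_GammaL2:
  assumes K: "subgroup K (units_group :: 'a::{field,finite} monoid)"
  shows "gl_action K \<in> hom GammaL2 (BijGroup (\<Omega> K))"
proof -
  interpret group "GammaL2 :: (('a^2^2) \<times> ('a \<Rightarrow> 'a)) monoid" by (rule group_GammaL2)
  have maps: "gl_action K x \<alpha> \<in> \<Omega> K" if xa: "x \<in> carrier GammaL2" "\<alpha> \<in> \<Omega> K" for x \<alpha>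
  proof -
    obtain T \<sigma> where x: "x = (T, \<sigma>)" "T \<in> carrier GL2" "\<sigma> \<in> carrier Galois"
      using xa(1) by (auto simp: GammaL2_def semidirect_def)
    obtain v where v: "\<alpha> = orb K v" "v \<noteq> 0" using xa by (auto simp: \<Omega>_def)
    show ?thesis using gl_action_eq[OF K x(3) v(2)] semilinear_nz[OF x(2,3) v(2)]
      by (auto simp: x v \<Omega>_def)
  qed
  have mult: "gl_action K (x \<otimes>\<^bsub>GammaL2\<^esub> y) \<alpha> = gl_action K x (gl_action K y \<alpha>)"
    if xy: "x \<in> carrier GammaL2" "y \<in> carrier GammaL2" "\<alpha> \<in> \<Omega> K" for x y \<alpha>
  proof -
    obtain T \<sigma> where x: "x = (T, \<sigma>)" "T \<in> carrier GL2" "\<sigma> \<in> carrier Galois"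
      using xy by (auto simp: GammaL2_def semidirect_def)
    obtain S \<tau> where y: "y = (S, \<tau>)" "S \<in> carrier GL2" "\<tau> \<in> carrier Galois"
      using xy by (auto simp: GammaL2_def semidirect_def)
    obtain v where v: "\<alpha> = orb K v" "v \<noteq> 0" using xy by (auto simp: \<Omega>_def)
    have e: "x \<otimes>\<^bsub>GammaL2\<^esub> y = (T ** galois_mat \<sigma> S, \<sigma> \<circ> \<tau>)"
      by (simp add: x y GammaL2_def semidirect_def GL2_def Galois_def)
    have st: "\<sigma> \<circ> \<tau> \<in> carrier Galois"
      using m_closed[OF xy(1,2)] unfolding e by (simp add: GammaL2_def semidirect_def)
    have c: "galois_vec (\<sigma> \<circ> \<tau>) v = galois_vec \<sigma> (galois_vec \<tau> v)"
      by (simp add: galois_vec_def)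
    show ?thesis
      unfolding e
      using gl_action_eq[OF K st v(2)] gl_action_eq[OF K y(3) v(2)]
        gl_action_eq[OF K x(3) semilinear_nz[OF y(2,3) v(2)]]
      by (simp add: x y v c galois_mat_vec[OF x(3)] matrix_vector_mul_assoc matrix_mul_assoc)
  qed
  have one: "gl_action K \<one>\<^bsub>GammaL2\<^esub> \<alpha> = \<alpha>" if a: "\<alpha> \<in> \<Omega> K" for \<alpha>
  proof -
    obtain v where v: "\<alpha> = orb K v" "v \<noteq> 0" using a by (auto simp: \<Omega>_def)
    have "id \<in> carrier (Galois :: ('a \<Rightarrow> 'a) monoid)" by (simp add: Galois_iff)
    from gl_action_eq[OF K this v(2)] show ?thesis
      by (simp add: v GammaL2_def semidirect_def GL2_def Galois_def galois_vec_def)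
  qed
  have bij: "gl_action K x \<in> Bij (\<Omega> K)" if x: "x \<in> carrier GammaL2" for x
  proof -
    have "bij_betw (gl_action K x) (\<Omega> K) (\<Omega> K)"
    proof (rule bij_betw_byWitness[of _ "gl_action K (inv\<^bsub>GammaL2\<^esub> x)"])
      show "\<forall>\<alpha>\<in>\<Omega> K. gl_action K (inv\<^bsub>GammaL2\<^esub> x) (gl_action K x \<alpha>) = \<alpha>"
        using mult[OF inv_closed[OF x] x] one x by simp
      show "\<forall>\<alpha>\<in>\<Omega> K. gl_action K x (gl_action K (inv\<^bsub>GammaL2\<^esub> x) \<alpha>) = \<alpha>"
        using mult[OF x inv_closed[OF x]] one x by simp
    qed (use maps[OF x] maps[OF inv_closed[OF x]] in blast)+
    then show ?thesis by (auto simp: Bij_def gl_action_def split: prod.splits)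
  qed
  have "gl_action K (x \<otimes>\<^bsub>GammaL2\<^esub> y) = compose (\<Omega> K) (gl_action K x) (gl_action K y)"
    if "x \<in> carrier GammaL2" "y \<in> carrier GammaL2" for x y
  proof
    fix \<alpha>
    show "gl_action K (x \<otimes>\<^bsub>GammaL2\<^esub> y) \<alpha> = compose (\<Omega> K) (gl_action K x) (gl_action K y) \<alpha>"
      using mult[OF that] by (cases "\<alpha> \<in> \<Omega> K")
        (auto simp: compose_def gl_action_def split: prod.splits)
  qed
  then show ?thesis using bij by (auto simp: hom_def BijGroup_def)
qed

end

theory Submission
  imports Defs
begin

text \<open>
  Write \<open>m = |K|\<close>. As \<open>K\<close> is the set of roots of \<open>x^m = 1\<close>, the class \<open>K x\<close> is determined by
  \<open>N x = x^m\<close>, and the theorem becomes a statement about the power map \<open>N\<close> on the field.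

  That both groups of semilinear maps act as claimed is a computation: a pair \<open>(T, \<sigma>)\<close> takes
  \<open>r\<close> at the class of \<open>y\<close> to \<open>r\<close> at the class of \<open>\<sigma> y\<close>, and \<open>s\<close> at \<open>y\<close> to \<open>s\<close> at \<open>det T \<sigma> y\<close>
  (\<open>rel_image_gl_action_r\<close>, \<open>rel_image_gl_action_s\<close>). The content is that every isomorphism \<open>f\<close> is
  semilinear. The relations \<open>r\<^sub>g\<close> are graphs of permutations and the relations \<open>s\<^sub>g\<close> are not, so \<open>f\<close>
  permutes each of the two families. Let \<open>p, q\<close> be representatives of the images of the two
  standard basis vectors. Then \<open>f\<close> sends the class of \<open>(1, t)\<close> to the class of \<open>p + l(t) q\<close> for
  a function \<open>l\<close> on the field, and comparing determinants gives
  \<open>N (l b - l a) = N (l (b - a))\<close>, where \<open>N l\<close> is multiplicative and \<open>N (l x)\<close> determines and is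
  determined by \<open>N x\<close>. Such an \<open>l\<close> is called a cyclotomic similarity here. It remains to show that
  \<open>l\<close> is a field automorphism up to a factor; \<open>f\<close> is then given by \<open>l\<close> and \<open>p, q\<close>
  (\<open>semilinear_if_preserves_classes\<close>).

  Additivity of \<open>l\<close> is a twisted form of a theorem of Carlitz and McConnel. As the group of classes
  is cyclic, \<open>N x = (N (l x))^k\<close> for some \<open>k\<close>, whence \<open>(l x - l y)^(m k) = (x - y)^m\<close>. Passing to
  \<open>g = l^P\<close>, where \<open>P\<close> is the largest power of the characteristic that divides \<open>m k\<close>, gives
  \<open>(g x - g y)^s = (x - y)^m\<close> with \<open>s\<close> nonzero in the field. Averaging this identity over \<open>y\<close> with suitable
  weights isolates single terms of the binomial expansion and shows that both \<open>g - g y\<close> and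
  \<open>(g - g y)^(s - 1)\<close> are polynomials of degree at most \<open>m\<close>. Their product has degree at most
  \<open>2 m < |\<F>|\<close>, so it equals \<open>(x - y)^m\<close> as a polynomial and not only as a function. Hence
  \<open>g x - g y = c (x - y)^e\<close>; here \<open>c\<close> and \<open>e\<close> are the leading coefficient and the degree of \<open>g\<close>, the same
  for all \<open>y\<close>, and therefore \<open>g\<close> is additive (\<open>additive_if_preserves_difference_powers\<close>).

  Finally \<open>x \<mapsto> 1 / l (1 / x)\<close> is a cyclotomic similarity too, so it is additive as well, and
  an identity of Hua turns additivity of both maps into multiplicativity of \<open>l / l 1\<close>
  (\<open>additive_inverse_additive_imp_mult\<close>).
\<close>

section \<open>Power sums over a finite field\<close>

lemma finite_field_generator:
  obtains w :: "'a::{field,finite}" where "w \<noteq> 0" and "\<And>x. x \<noteq> 0 \<Longrightarrow> \<exists>i. x = w ^ i"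
proof -
  interpret F: Ring.field "FF :: 'a ring" by (rule field_from_type_algebra)
  obtain w :: 'a where w: "w \<in> carrier (Multiplicative_Group.mult_of FF)"
    and gen: "carrier (Multiplicative_Group.mult_of FF) = {w [^]\<^bsub>FF\<^esub> i | i::nat. i \<in> UNIV}"
    using F.finite_field_mult_group_has_gen by auto
  have pw: "w [^]\<^bsub>FF\<^esub> (i::nat) = w ^ i" for i
    by (induction i) (simp_all add: mult.commute)
  show thesis
  proof
    show "w \<noteq> 0" using w by simp
    fix x :: 'a assume "x \<noteq> 0"
    then have "x \<in> carrier (Multiplicative_Group.mult_of FF)" by simp
    then show "\<exists>i. x = w ^ i" unfolding gen by (auto simp: pw)
  qed
qed

lemma card_field_ge_2: "CARD('a::{field,finite}) \<ge> 2"
  using card_mono[of UNIV "{0, 1 :: 'a}"] by simp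

lemma power_card_minus_one:
  fixes x :: "'a::{field,finite}"
  assumes "x \<noteq> 0" shows "x ^ (CARD('a) - 1) = 1"
proof -
  have "inj ((*) x)" using assms by (auto simp: inj_on_def)
  then have "bij_betw ((*) x) (UNIV - {0}) (UNIV - {0})"
    using assms by (intro bij_betw_imageI endo_inj_surj) (auto simp: inj_on_def)
  then have "(\<Prod>z\<in>UNIV - {0}. z) = (\<Prod>z\<in>UNIV - {0}. x * z)"
    by (rule prod.reindex_bij_betw[symmetric])
  also have "\<dots> = x ^ (CARD('a) - 1) * (\<Prod>z\<in>UNIV - {0}. z)"
    by (simp add: prod.distrib card_Diff_singleton)
  finally show ?thesis by (simp add: prod_zero_iff)
qed

text \<open>
  If \<open>w ^ j = 1\<close> with \<open>0 < j < |\<F>| - 1\<close>, then the powers of \<open>w\<close> would be too few to cover all nonzero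
  elements; the exponent is first reduced modulo \<open>|\<F>| - 1\<close>.
\<close>

lemma generator_power_eq_one:
  fixes w :: "'a::{field,finite}"
  assumes w0: "w \<noteq> 0" and gen: "\<And>x. x \<noteq> 0 \<Longrightarrow> \<exists>i. x = w ^ i" and "w ^ j = 1"
  shows "CARD('a) - 1 dvd j"
proof (rule ccontr)
  assume nd: "\<not> CARD('a) - 1 dvd j"
  let ?r = "j mod (CARD('a) - 1)"
  have pos: "CARD('a) - 1 > 0" using card_field_ge_2[where ?'a='a] by simp
  have r: "w ^ ?r = 1" 
  proof -
    have "w ^ j = (w ^ (CARD('a) - 1)) ^ (j div (CARD('a) - 1)) * w ^ ?r"
      by (simp flip: power_mult power_add)
    then show ?thesis using assms by (simp del: One_nat_def add: power_card_minus_one)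
  qed
  have r0: "?r > 0" using nd by (simp add: dvd_eq_mod_eq_0)
  have "UNIV - {0} \<subseteq> (\<lambda>i. w ^ i) ` {..<?r}"
  proof
    fix x :: 'a assume "x \<in> UNIV - {0}"
    then obtain i where i: "x = w ^ i" using gen by auto
    have "x = (w ^ ?r) ^ (i div ?r) * w ^ (i mod ?r)" 
      by (simp add: i flip: power_mult power_add)
    then show "x \<in> (\<lambda>i. w ^ i) ` {..<?r}" using r r0 by auto
  qed
  then have "card (UNIV - {0::'a}) \<le> ?r"
    using card_mono[of "(\<lambda>i. w ^ i) ` {..<?r}" "UNIV - {0}"] card_image_le[of "{..<?r}" "\<lambda>i. w ^ i"]
    by simp
  moreover have "?r < CARD('a) - 1" using pos by simp
  ultimately show False by (simp add: card_Diff_singleton)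
qed

text \<open>
  Multiplication by a generator permutes the field and multiplies the sum by \<open>w ^ j \<noteq> 1\<close>.
\<close>

lemma power_sum_eq_0:
  assumes nd: "\<not> CARD('a::{field,finite}) - 1 dvd j"
  shows "(\<Sum>z\<in>UNIV. z ^ j :: 'a) = 0"
proof -
  obtain w :: 'a where w0: "w \<noteq> 0" and gen: "\<And>x. x \<noteq> 0 \<Longrightarrow> \<exists>i. x = w ^ i"
    by (rule finite_field_generator) blast
  have "bij ((*) w)"
    using w0 by (intro finite_UNIV_inj_surj bijI) (auto simp: inj_on_def intro!: finite_UNIV_inj_surj)
  then have "(\<Sum>z\<in>UNIV. z ^ j) = (\<Sum>z\<in>UNIV. (w * z) ^ j)"
    by (rule sum.reindex_bij_betw[symmetric])
  also have "\<dots> = w ^ j * (\<Sum>z\<in>UNIV. z ^ j)"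
    by (simp add: power_mult_distrib sum_distrib_left)
  finally have "(w ^ j - 1) * (\<Sum>z\<in>UNIV. z ^ j) = 0" by (simp add: algebra_simps)
  moreover have "w ^ j \<noteq> 1" using generator_power_eq_one[OF w0 gen] nd by blast
  ultimately show ?thesis by simp
qed

lemma power_sum_card_minus_one:
  "(\<Sum>z\<in>UNIV. z ^ (CARD('a) - 1) :: 'a::{field,finite}) = - 1"
proof -
  \<comment> \<open>Translation by \<open>1\<close> permutes the field, so its size is \<open>0\<close> as an element of the field.\<close>
  have "(\<Sum>z\<in>UNIV. z :: 'a) = (\<Sum>z\<in>UNIV. z + 1)"
    by (rule sum.reindex_bij_betw[of "\<lambda>z. z + 1", symmetric])
       (auto intro!: bijI finite_UNIV_inj_surj simp: inj_on_def)
  then have q0: "of_nat CARD('a) = (0 :: 'a)" by (simp add: sum.distrib)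
  note c2 = card_field_ge_2[where ?'a='a]
  have "(\<Sum>z\<in>UNIV. z ^ (CARD('a) - 1) :: 'a) = (\<Sum>z\<in>UNIV - {0}. z ^ (CARD('a) - 1))"
    using c2 by (intro sum.mono_neutral_right) (auto simp: power_0_left)
  also have "\<dots> = (\<Sum>z\<in>UNIV - {0 :: 'a}. 1)" by (intro sum.cong) (auto simp del: One_nat_def simp: power_card_minus_one)
  also have "\<dots> = of_nat (CARD('a) - 1)" by (simp add: card_Diff_singleton)
  also have "\<dots> = - 1" using q0 c2 by (simp add: of_nat_diff)
  finally show ?thesis .
qed

section \<open>Functions preserving powers of differences\<close>

text \<open>
  The right-hand side of the hypothesis has degree \<open>m\<close> in \<open>x\<close> for each fixed \<open>y\<close>, so linear combinations
  over \<open>y\<close> have degree at most \<open>m\<close>. On the left, \<open>z = g y\<close> runs through the whole field, so power sums with the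
  weights \<open>z ^ b\<close> pick out the term \<open>g x ^ a\<close> of the binomial expansion of \<open>(g x - z) ^ s\<close>.
\<close>

lemma power_is_poly_of_small_degree:
  fixes g :: "'a::{field,finite} \<Rightarrow> 'a"
  assumes inj: "inj g" and g: "\<And>x y. (g x - g y) ^ s = (x - y) ^ m"
    and s: "s < CARD('a) - 1" and a: "a \<le> s" "of_nat (s choose a) \<noteq> (0 :: 'a)"
  shows "\<exists>P. Polynomial.degree P \<le> m \<and> (\<forall>x. poly P x = g x ^ a)"
proof -
  \<comment> \<open>With this weight the exponent of \<open>z\<close> in the \<open>i\<close>-th term is \<open>|\<F>| - 1 + a - i\<close>. As \<open>s < |\<F>| - 1\<close>, it is
    positive, and it is a multiple of \<open>|\<F>| - 1\<close> only for \<open>i = a\<close>.\<close>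
  define b where "b = CARD('a) - 1 - (s - a)"
  define c where "c = - of_nat (s choose a) * (-1 :: 'a) ^ (s - a)"
  have c0: "c \<noteq> 0" using a by (simp add: c_def)
  have bij: "bij g" using inj by (intro bijI finite_UNIV_inj_surj) auto
  have key: "(\<Sum>y\<in>UNIV. g y ^ b * (x - y) ^ m) = c * g x ^ a" for x
  proof -
    have "(\<Sum>y\<in>UNIV. g y ^ b * (x - y) ^ m) = (\<Sum>y\<in>UNIV. g y ^ b * (g x - g y) ^ s)"
      by (simp add: g)
    also have "\<dots> = (\<Sum>z\<in>UNIV. z ^ b * (g x - z) ^ s)"
      by (rule sum.reindex_bij_betw[OF bij])
    also have "\<dots> = (\<Sum>z\<in>UNIV. \<Sum>i\<le>s. of_nat (s choose i) * (-1) ^ (s - i) * g x ^ i * z ^ (b + (s - i)))"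
    proof (rule sum.cong[OF refl])
      fix z :: 'a
      have "(g x - z) ^ s = (g x + - z) ^ s" by simp
      also have "\<dots> = (\<Sum>i\<le>s. of_nat (s choose i) * g x ^ i * (- z) ^ (s - i))" by (rule binomial_ring)
      finally show "z ^ b * (g x - z) ^ s = 
        (\<Sum>i\<le>s. of_nat (s choose i) * (-1) ^ (s - i) * g x ^ i * z ^ (b + (s - i)))"
        by (simp only: sum_distrib_left power_add power_minus[of z] ac_simps)
    qed
    also have "\<dots> = (\<Sum>i\<le>s. of_nat (s choose i) * (-1) ^ (s - i) * g x ^ i * (\<Sum>z\<in>UNIV. z ^ (b + (s - i))))"
      by (subst sum.swap) (simp add: sum_distrib_left)
    also have "\<dots> = (\<Sum>i\<le>s. if i = a then c * g x ^ a else 0)"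
    proof (rule sum.cong[OF refl])
      fix i assume i: "i \<in> {..s}"
      show "of_nat (s choose i) * (-1) ^ (s - i) * g x ^ i * (\<Sum>z\<in>UNIV. z ^ (b + (s - i)))
        = (if i = a then c * g x ^ a else 0)"
      proof (cases "i = a")
        case True
        have "b + (s - i) = CARD('a) - 1" using True s a by (simp add: b_def)
        then show ?thesis using True by (simp del: One_nat_def add: power_sum_card_minus_one c_def)
      next
        case False
        have "\<not> CARD('a) - 1 dvd b + (s - i)"
        proof
          assume "CARD('a) - 1 dvd b + (s - i)"
          then obtain l where l: "b + (s - i) = (CARD('a) - 1) * l" by (elim dvdE)
          have "b + (s - i) + i = CARD('a) - 1 + a" using s a i by (simp add: b_def)
          moreover have "0 < b + (s - i)" "b + (s - i) < 2 * (CARD('a) - 1)" using s a i by (simp_all add: b_def)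
          ultimately have "l > 0" "l < 2" unfolding l by (auto simp: mult.commute)
          then have "b + (s - i) = CARD('a) - 1" using l by (simp del: One_nat_def)
          then show False using False \<open>b + (s - i) + i = CARD('a) - 1 + a\<close> by linarith
        qed
        then show ?thesis using False by (simp add: power_sum_eq_0)
      qed
    qed
    also have "\<dots> = c * g x ^ a" using a by simp
    finally show ?thesis .
  qed
  define P where "P = Polynomial.smult (inverse c) (\<Sum>y\<in>UNIV. Polynomial.smult (g y ^ b) ([:- y, 1:] ^ m))"
  have "Polynomial.degree P \<le> m" unfolding P_def
    by (intro order.trans[OF degree_smult_le] degree_sum_le) (auto simp: degree_linear_power)
  moreover have "poly P x = g x ^ a" for x
    using key[of x] c0 by (simp add: P_def poly_sum poly_power field_simps)
  ultimately show ?thesis by blast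
qed

text \<open>
  The order of vanishing at \<open>y\<close> is additive and bounded by the degree. For \<open>P * Q\<close> it equals the degree,
  so it does for \<open>P\<close>.
\<close>

lemma divisor_of_linear_power:
  fixes P Q :: "'a::field poly"
  assumes "P * Q = [:- y, 1:] ^ m"
  shows "P = Polynomial.smult (Polynomial.lead_coeff P) ([:- y, 1:] ^ Polynomial.degree P)"
proof -
  define e where "e = Polynomial.degree P"
  have nz: "P * Q \<noteq> 0" by (simp add: assms)
  then have P0: "P \<noteq> 0" and Q0: "Q \<noteq> 0" by auto
  have "Polynomial.order y P + Polynomial.order y Q = m"
    using order_mult[OF nz, of y] by (simp add: assms order_power_n_n)
  moreover have "e + Polynomial.degree Q = m"
    using degree_mult_eq[OF P0 Q0] by (simp add: assms degree_linear_power e_def)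
  ultimately have "Polynomial.order y P = e"
    using order_degree[OF P0, of y] order_degree[OF Q0, of y] by (simp add: e_def)
  then obtain R where R: "P = [:- y, 1:] ^ e * R"
    using order_1[of y P] by (auto elim: dvdE)
  then have "R \<noteq> 0" using P0 by auto
  then have "Polynomial.degree ([:- y, 1:] ^ e * R) = e + Polynomial.degree R"
    using degree_mult_eq[of "[:- y, 1:] ^ e" R] by (simp add: degree_linear_power)
  then have "e = e + Polynomial.degree R" unfolding R[symmetric] unfolding e_def .
  then obtain r where r: "R = [:r:]" by (auto elim: degree_eq_zeroE)
  have P: "P = Polynomial.smult r ([:- y, 1:] ^ e)" using R by (simp add: r)
  have lead: "Polynomial.lead_coeff P = r"
    by (subst (1 2) P) (simp only: lead_coeff_smult lead_coeff_power, simp)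
  show ?thesis unfolding lead unfolding e_def[symmetric] by (rule P)
qed

text \<open>
  The exponents \<open>a = 1\<close> and \<open>a = s - 1\<close> both have \<open>s choose a = s\<close>, which is nonzero in the field, so the
  previous lemmas apply to the two factors of \<open>h * h ^ (s - 1)\<close> with \<open>h x = g x - g y\<close>. The bound on \<open>m\<close> is what
  bounds the degree of their product below the field size and so makes its equality with \<open>(x - y) ^ m\<close> one of
  polynomials; both factors are then powers of \<open>x - y\<close> up to constants.
\<close>

lemma additive_if_preserves_difference_powers:
  fixes g :: "'a::{field,finite} \<Rightarrow> 'a"
  assumes inj: "inj g" and g: "\<And>x y. (g x - g y) ^ s = (x - y) ^ m"
    and s: "s < CARD('a) - 1" "of_nat s \<noteq> (0 :: 'a)" and m: "2 * m < CARD('a)"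
  shows "g (x + y) - g y = g x - g 0"
proof -
  have s0: "s > 0" using s(2) by (cases s) auto
  have choose_pred: "s choose (s - 1) = s"
    using s0 binomial_symmetric[of "s - 1" s] by simp
  let ?good = "\<lambda>y P. (\<forall>x. poly P x = g x - g y) \<and> Polynomial.degree P \<le> m \<and>
      P = Polynomial.smult (Polynomial.lead_coeff P) ([:- y, 1:] ^ Polynomial.degree P)"
  have "\<forall>y. \<exists>P. ?good y P"
  proof
    fix y
    let ?h = "\<lambda>x. g x - g y"
    have inj_h: "inj ?h" using inj by (auto simp: inj_on_def)
    have h: "(?h x - ?h z) ^ s = (x - z) ^ m" for x z by (simp add: g)
    obtain P where P: "Polynomial.degree P \<le> m" "\<And>x. poly P x = ?h x"
      using power_is_poly_of_small_degree[OF inj_h h s(1), of 1] s s0 by auto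
    obtain Q where Q: "Polynomial.degree Q \<le> m" "\<And>x. poly Q x = ?h x ^ (s - 1)"
      using power_is_poly_of_small_degree[OF inj_h h s(1), of "s - 1"] s s0 choose_pred
      by (auto simp: choose_pred)
    have "P * Q = [:- y, 1:] ^ m"
    proof (rule poly_eqI_degree[of UNIV])
      show "poly (P * Q) x = poly ([:- y, 1:] ^ m) x" for x
      proof -
        have "poly (P * Q) x = (g x - g y) * (g x - g y) ^ (s - 1)" by (simp only: poly_mult P Q)
        also have "\<dots> = (g x - g y) ^ s" using s0 by (simp add: power_eq_if[of _ s])
        finally show ?thesis by (simp add: g poly_power)
      qed
      show "Polynomial.degree (P * Q) < CARD('a)"
        using degree_mult_le[of P Q] P(1) Q(1) m by linarith
      show "Polynomial.degree ([:- y, 1:] ^ m) < CARD('a)"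
        using m by (simp add: degree_linear_power)
    qed
    note eq = divisor_of_linear_power[OF this]
    show "\<exists>P. ?good y P" using P eq by (intro exI[of _ P] conjI allI)
  qed
  from choice[OF this] obtain P where "\<forall>y. ?good y (P y)" ..
  then have good: "?good y (P y)" for y by (rule spec)
  have P: "poly (P y) x = g x - g y" for x y using conjunct1[OF good] by (rule spec)
  have deg_le: "Polynomial.degree (P y) \<le> m" for y using conjunct2[OF good] by (rule conjunct1)
  have P_eq: "P y = Polynomial.smult (Polynomial.lead_coeff (P y)) ([:- y, 1:] ^ Polynomial.degree (P y))"
    for y using conjunct2[OF good] by (rule conjunct2)
  \<comment> \<open>The polynomials for different \<open>y\<close> differ by constants only; as they are not constant, they share degree
    and leading coefficient.\<close>
  have shift: "P y = P 0 + [:g 0 - g y:]" for y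
  proof (rule poly_eqI_degree[of UNIV])
    show "Polynomial.degree (P y) < CARD('a)" using deg_le[of y] m by linarith
    have "Polynomial.degree (P 0 + [:g 0 - g y:]) \<le> m"
      using deg_le[of 0] by (intro degree_add_le) auto
    then show "Polynomial.degree (P 0 + [:g 0 - g y:]) < CARD('a)" using m by linarith
  qed (simp add: P)
  have deg0: "Polynomial.degree (P 0) > 0"
  proof (rule ccontr)
    assume "\<not> ?thesis"
    then obtain c where c: "P 0 = [:c:]" by (auto elim: degree_eq_zeroE)
    have "poly (P 0) 0 = poly (P 0) 1" unfolding c by simp
    then have "g 0 = g 1" unfolding P by simp
    then show False using injD[OF inj, of 0 1] by simp
  qed
  have deg: "Polynomial.degree (P y) = Polynomial.degree (P 0)" for y
    unfolding shift[of y] by (rule degree_add_eq_left) (use deg0 in simp)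
  have lead: "Polynomial.lead_coeff (P y) = Polynomial.lead_coeff (P 0)" for y
    unfolding deg[of y] unfolding shift[of y] using deg0 by (simp add: coeff_pCons split: nat.split)
  have diff: "g x - g y = Polynomial.lead_coeff (P 0) * (x - y) ^ Polynomial.degree (P 0)" for x y
  proof -
    have "g x - g y = poly (P y) x" by (rule P[symmetric])
    also have "\<dots> = poly (Polynomial.smult (Polynomial.lead_coeff (P y)) ([:- y, 1:] ^ Polynomial.degree (P y))) x"
      by (rule arg_cong[OF P_eq])
    also have "\<dots> = Polynomial.lead_coeff (P y) * (x - y) ^ Polynomial.degree (P y)"
      by (simp add: poly_power)
    finally show ?thesis unfolding lead[of y] unfolding deg[of y] .
  qed
  show ?thesis using diff[of "x + y" y] diff[of x 0] by simp
qed

section \<open>Cyclotomic similarities are semilinear\<close>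

text \<open>
  For \<open>m > 0\<close> the power \<open>x ^ m\<close> stands for the class of \<open>x\<close> modulo the roots of \<open>x ^ m = 1\<close>, with \<open>0\<close> in a class of its
  own. So the clauses say that \<open>l\<close> fixes \<open>0\<close> and acts on the classes of differences, and that this
  action is injective and multiplicative. Over a finite field, \<open>l\<close> then permutes the classes of
  differences through a group automorphism, which need not be trivial.
\<close>

definition cyclotomic_similarity :: "nat \<Rightarrow> ('a::field \<Rightarrow> 'a) \<Rightarrow> bool" where
  "cyclotomic_similarity m l \<longleftrightarrow> l 0 = 0 \<and>
    (\<forall>a b. (l b - l a) ^ m = l (b - a) ^ m) \<and>
    (\<forall>x y. l x ^ m = l y ^ m \<longleftrightarrow> x ^ m = y ^ m) \<and>
    (\<forall>x y. l (x * y) ^ m = l x ^ m * l y ^ m)"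

lemma cyclotomic_similarityD:
  assumes "cyclotomic_similarity m l"
  shows "l 0 = 0" and "(l b - l a) ^ m = l (b - a) ^ m"
    and "l x ^ m = l y ^ m \<longleftrightarrow> x ^ m = y ^ m" and "l (x * y) ^ m = l x ^ m * l y ^ m"
  using assms by (auto simp: cyclotomic_similarity_def)

lemma cyclotomic_similarity_inj:
  assumes l: "cyclotomic_similarity m l" and m: "m > 0"
  shows "inj l"
proof (rule injI)
  fix a b assume "l a = l b"
  then have "l (b - a) ^ m = l 0 ^ m"
    using cyclotomic_similarityD(2)[OF l, of b a] cyclotomic_similarityD(1)[OF l] m by simp
  then have "(b - a) ^ m = 0" using cyclotomic_similarityD(3)[OF l] m by (simp add: power_0_left)
  then show "a = b" using m by simp
qed

lemma cyclotomic_similarity_eq_0_iff: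
  assumes l: "cyclotomic_similarity m l" and m: "m > 0"
  shows "l x = 0 \<longleftrightarrow> x = 0"
  using cyclotomic_similarity_inj[OF assms] cyclotomic_similarityD(1)[OF l] by (metis injD)

lemma cyclotomic_similarity_one:
  assumes l: "cyclotomic_similarity m l" and m: "m > 0"
  shows "l 1 ^ m = 1"
  using cyclotomic_similarityD(4)[OF l, of 1 1] cyclotomic_similarity_eq_0_iff[OF l m, of 1] by simp

lemma cyclotomic_similarity_power:
  assumes l: "cyclotomic_similarity m l" and m: "m > 0"
  shows "l (x ^ i) ^ m = (l x ^ m) ^ i"
  by (induction i) (simp_all add: cyclotomic_similarity_one[OF l m] cyclotomic_similarityD(4)[OF l])

text \<open>
  The classes form a cyclic group, on which the automorphism induced by \<open>l\<close> and its inverse are power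
  maps. The exponent of the inverse is read off a preimage \<open>y = w ^ k0\<close> of a generator \<open>w\<close> under \<open>l\<close>, and is then
  reduced modulo the order \<open>n\<close> of the group.
\<close>

lemma cyclotomic_similarity_exponent:
  fixes l :: "'a::{field,finite} \<Rightarrow> 'a"
  assumes l: "cyclotomic_similarity m l" and mn: "m * n = CARD('a) - 1" "n \<ge> 2"
  obtains k where "0 < k" "k < n" "\<And>x. x ^ m = (l x ^ m) ^ k"
proof -
  have m: "m > 0" using mn card_field_ge_2[where ?'a='a] by (cases m) auto
  obtain w :: 'a where w0: "w \<noteq> 0" and gen: "\<And>x. x \<noteq> 0 \<Longrightarrow> \<exists>i. x = w ^ i"
    by (rule finite_field_generator) blast
  have "surj l" using cyclotomic_similarity_inj[OF l m] by (simp add: finite_UNIV_inj_surj)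
  then obtain y where y: "l y = w" by (metis surjD)
  then have "y \<noteq> 0" using w0 cyclotomic_similarityD(1)[OF l] by auto
  then obtain k0 where k0: "y = w ^ k0" using gen by blast
  have "w ^ m = (l w ^ m) ^ k0"
    using cyclotomic_similarity_power[OF l m, of w k0] y k0 by simp
  also have "\<dots> = (l w ^ m) ^ (n * (k0 div n)) * (l w ^ m) ^ (k0 mod n)"
    by (simp flip: power_add)
  also have "(l w ^ m) ^ (n * (k0 div n)) = (l w ^ (CARD('a) - 1)) ^ (k0 div n)"
    unfolding mn(1)[symmetric] by (simp add: power_mult)
  also have "l w ^ (CARD('a) - 1) = 1"
    using w0 cyclotomic_similarity_eq_0_iff[OF l m] by (intro power_card_minus_one) simp
  finally have w: "w ^ m = (l w ^ m) ^ (k0 mod n)" by simp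
  \<comment> \<open>Exponent \<open>0\<close> would make every class trivial, although there are \<open>n \<ge> 2\<close> of them.\<close>
  have k: "k0 mod n > 0"
  proof (rule ccontr)
    assume "\<not> ?thesis"
    then have "w ^ m = 1" using w by simp
    then have "m * n dvd m" using generator_power_eq_one[OF w0 gen] mn by simp
    then show False using m mn(2) by (auto dest: dvd_imp_le)
  qed
  show thesis
  proof
    fix x :: 'a
    show "x ^ m = (l x ^ m) ^ (k0 mod n)"
    proof (cases "x = 0")
      case True
      then show ?thesis using m k cyclotomic_similarityD(1)[OF l] by (simp add: power_0_left)
    next
      case False
      then obtain i where x: "x = w ^ i" using gen by blast
      have "x ^ m = (w ^ m) ^ i" by (simp add: x mult.commute flip: power_mult)
      also have "\<dots> = ((l w ^ m) ^ i) ^ (k0 mod n)"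
        by (subst w) (simp add: ac_simps flip: power_mult)
      finally show ?thesis by (simp add: x cyclotomic_similarity_power[OF l m])
    qed
  qed (use k mn in auto)
qed

lemma frobenius_diff:
  fixes x y :: "'a::{field,finite}"
  shows "(x - y) ^ (CHAR('a) ^ i) = x ^ (CHAR('a) ^ i) - y ^ (CHAR('a) ^ i)"
proof -
  have "prime CHAR('a)" by (simp add: finite_imp_CHAR_pos prime_CHAR_semidom)
  from freshmans_dream'[OF this refl, of "x - y" y i] show ?thesis by simp
qed

text \<open>
  The exponent \<open>k\<close> of the inverse class automorphism is used on the side of \<open>l\<close>, so that the other
  side is \<open>(x - y) ^ m\<close> with the small exponent \<open>m < |\<F>| / 2\<close>. The largest power of the characteristic that divides
  \<open>m * k\<close> is moved into a Frobenius twist \<open>g\<close> of \<open>l\<close>, which is additive exactly if \<open>l\<close> is.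
\<close>

lemma cyclotomic_similarity_additive:
  fixes l :: "'a::{field,finite} \<Rightarrow> 'a"
  assumes l: "cyclotomic_similarity m l" and mn: "m * n = CARD('a) - 1" "n \<ge> 2"
  shows "l (x + y) = l x + l y"
proof -
  let ?p = "CHAR('a)"
  have m: "m > 0" using mn card_field_ge_2[where ?'a='a] by (cases m) auto
  obtain k where k: "0 < k" "k < n" "\<And>x. x ^ m = (l x ^ m) ^ k"
    by (rule cyclotomic_similarity_exponent[OF assms]) blast
  have p: "prime ?p" by (simp add: finite_imp_CHAR_pos prime_CHAR_semidom)
  have "m * k \<noteq> 0" "\<not> is_unit ?p" using m k p by auto
  from multiplicity_decompose'[OF this] obtain s where s: "m * k = ?p ^ multiplicity ?p (m * k) * s" "\<not> ?p dvd s" .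
  define i where "i = multiplicity ?p (m * k)"
  define g where "g x = l x ^ (?p ^ i)" for x
  have p0: "?p ^ i > 0" using p by (simp add: prime_gt_0_nat)
  have frob: "g x - g y = (l x - l y) ^ (?p ^ i)" for x y
    by (simp add: g_def frobenius_diff)
  have "g (x + y) - g y = g x - g 0"
  proof (rule additive_if_preserves_difference_powers[where s = s and m = m])
    show "inj g"
    proof (rule injI)
      fix a b assume "g a = g b"
      then have "l a = l b" using frob[of a b] p0 by simp
      then show "a = b" using cyclotomic_similarity_inj[OF l m] by (simp add: injD)
    qed
    show "(g a - g b) ^ s = (a - b) ^ m" for a b
    proof -
      have "(g a - g b) ^ s = ((l a - l b) ^ m) ^ k"
        using s(1) by (simp add: frob i_def flip: power_mult)
      then show ?thesis using k(3)[of "a - b"] by (simp add: cyclotomic_similarityD(2)[OF l])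
    qed
    have "1 * s \<le> ?p ^ i * s" using p0 by (intro mult_le_mono1) linarith
    then have "s \<le> m * k" using s(1) by (simp add: i_def)
    also have "\<dots> < m * n" using m k by simp
    finally show "s < CARD('a) - 1" using mn by simp
    show "of_nat s \<noteq> (0 :: 'a)" using s(2) by (simp add: of_nat_eq_0_iff_char_dvd)
    have "2 * m \<le> m * n" using mn(2) by (simp add: mult.commute)
    then show "2 * m < CARD('a)" using mn(1) card_field_ge_2[where ?'a='a] by linarith
  qed
  moreover have "g 0 = 0" using p0 by (simp add: g_def cyclotomic_similarityD(1)[OF l])
  ultimately have "(l (x + y) - l y - l x) ^ (?p ^ i) = 0"
    by (simp add: frobenius_diff g_def)
  then have "l (x + y) - l y - l x = 0" using p0 by simp
  then show ?thesis by (simp add: algebra_simps)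
qed

text \<open>
  This is the symmetry \<open>t \<mapsto> 1 / t\<close> of the projective line, which exchanges the two basis vectors. The
  convention \<open>1 / 0 = 0\<close> makes \<open>0\<close> a fixed point. For nonzero \<open>a\<close> and \<open>b\<close> the condition on differences holds since
  \<open>1 / l (1 / b) - 1 / l (1 / a)\<close> is \<open>l (1 / a) - l (1 / b)\<close> divided by \<open>l (1 / a) * l (1 / b)\<close>.
\<close>

lemma cyclotomic_similarity_inverse:
  fixes l :: "'a::{field,finite} \<Rightarrow> 'a"
  assumes l: "cyclotomic_similarity m l" and m: "m > 0"
  shows "cyclotomic_similarity m (\<lambda>x. inverse (l (inverse x)))"
proof -
  note D = cyclotomic_similarityD[OF l]
  note l0 = cyclotomic_similarity_eq_0_iff[OF l m]
  have inv: "inverse (l (inverse x)) ^ m = l x ^ m" for x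
  proof (cases "x = 0")
    case False
    then have "l x ^ m * l (inverse x) ^ m = 1"
      using D(4)[of x "inverse x"] cyclotomic_similarity_one[OF l m] by simp
    then show ?thesis using False l0 by (simp add: field_simps power_inverse)
  qed (simp add: D(1) m)
  have minus: "(- l x) ^ m = l (- x) ^ m" for x using D(2)[of 0 x] D(1) by simp
  have diff: "(inverse (l (inverse b)) - inverse (l (inverse a))) ^ m = inverse (l (inverse (b - a))) ^ m" for a b
  proof -
    consider "a = 0" | "b = 0" | "a \<noteq> 0" "b \<noteq> 0" by blast
    then show ?thesis
    proof cases
      case 1
      then show ?thesis by (simp add: D(1))
    next
      case 2
      have "(- inverse (l (inverse a))) ^ m = (- 1) ^ m * inverse (l (inverse a)) ^ m" by (rule power_minus)
      also have "\<dots> = (- l a) ^ m" by (simp only: inv power_minus[of "l a"])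
      also have "\<dots> = inverse (l (inverse (- a))) ^ m" by (simp only: inv minus)
      finally show ?thesis using 2 by (simp add: D(1))
    next
      case 3
      have "inverse (l (inverse b)) - inverse (l (inverse a))
        = (l (inverse a) - l (inverse b)) * (inverse (l (inverse a)) * inverse (l (inverse b)))"
        using 3 l0 by (simp add: field_simps)
      then have "(inverse (l (inverse b)) - inverse (l (inverse a))) ^ m
        = (l (inverse a) - l (inverse b)) ^ m * (inverse (l (inverse a)) ^ m * inverse (l (inverse b)) ^ m)"
        by (simp add: power_mult_distrib)
      also have "\<dots> = l ((inverse a - inverse b) * (a * b)) ^ m"
        by (simp add: D inv)
      also have "(inverse a - inverse b) * (a * b) = b - a" using 3 by (simp add: field_simps)
      finally show ?thesis by (simp add: inv)
    qed
  qed
  show ?thesis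
    unfolding cyclotomic_similarity_def using D diff inv by (simp del: inverse_mult_distrib)
qed

text \<open>
  Hua's argument: additivity of \<open>h\<close> applied to \<open>1 / x + 1 / (a - x) = a / (x * (a - x))\<close> gives
  \<open>g (x\<^sup>2 / a) = (g x)\<^sup>2 / g a\<close>. So \<open>g\<close> is multiplicative whenever one factor is a square, and every element of
  a finite field is a square or a difference of two squares.
\<close>

lemma additive_inverse_additive_imp_mult:
  fixes g h :: "'a::{field,finite} \<Rightarrow> 'a"
  assumes g: "\<And>x y. g (x + y) = g x + g y" and h: "\<And>x y. h (x + y) = h x + h y"
    and inj: "inj g" and g1: "g 1 = 1" and gh: "\<And>x. h (inverse x) = inverse (g x)"
  shows "g (x * y) = g x * g y"
proof -
  have g0: "g 0 = 0" using g[of 0 0] by (metis add_0 add_cancel_right_right)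
  have g_nz: "g x = 0 \<longleftrightarrow> x = 0" for x using inj g0 by (metis injD)
  have g_diff: "g (x - y) = g x - g y" for x y using g[of "x - y" y] by simp
  have hua: "g (x\<^sup>2 / a) = (g x)\<^sup>2 / g a" if a: "a \<noteq> 0" for x a
  proof -
    consider "x = 0" | "x = a" | "x \<noteq> 0" "x \<noteq> a" by blast
    then show ?thesis
    proof cases
      case 3
      have "inverse (x * (a - x) / a) = inverse x + inverse (a - x)"
        using 3 a by (simp add: field_simps)
      then have "inverse (g (x * (a - x) / a)) = inverse (g x) + inverse (g (a - x))"
        by (simp only: h flip: gh)
      also have "\<dots> = inverse (g x * (g a - g x) / g a)"
        using 3 a g_nz[of x] g_nz[of a] g_nz[of "a - x"] by (simp add: field_simps g_diff)
      finally have "g (x * (a - x) / a) = g x * (g a - g x) / g a"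
        by (simp only: inverse_eq_iff_eq)
      moreover have "x * (a - x) / a = x - x\<^sup>2 / a"
        using a by (simp add: field_simps power2_eq_square)
      ultimately have "g x - g (x\<^sup>2 / a) = g x * (g a - g x) / g a" by (simp add: g_diff)
      then show ?thesis using a g_nz[of a] by (simp add: field_simps power2_eq_square)
    qed (use a g_nz[of a] in \<open>simp_all add: g0 power2_eq_square\<close>)
  qed
  have inv: "g (1 / a) = 1 / g a" if "a \<noteq> 0" for a using hua[OF that, of 1] g1 by simp
  have sq: "g (x\<^sup>2) = (g x)\<^sup>2" for x using hua[of 1 x] g1 by simp
  have sq_mult: "g (x\<^sup>2 * b) = g (x\<^sup>2) * g b" for x b
  proof (cases "b = 0")
    case False
    then show ?thesis using hua[of "1 / b" x] by (simp add: inv sq)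
  qed (simp add: g0)
  show ?thesis
  \<comment> \<open>In characteristic 2 squaring is bijective; otherwise \<open>x = ((x + 1) / 2)\<^sup>2 - ((x - 1) / 2)\<^sup>2\<close>.\<close>
  proof (cases "(2 :: 'a) = 0")
    case True
    have "inj (\<lambda>x :: 'a. x\<^sup>2)"
    proof (rule injI)
      fix x y :: 'a assume "x\<^sup>2 = y\<^sup>2"
      then have "(x - y) * (x + y) = 0" by (simp add: algebra_simps power2_eq_square)
      moreover have "x + y = x - y" 
      proof -
        have "x + y = (x - y) + 2 * y" by (simp add: algebra_simps)
        then show ?thesis unfolding True by simp
      qed
      ultimately show "x = y" by simp
    qed
    then have "surj (\<lambda>x :: 'a. x\<^sup>2)" by (simp add: finite_UNIV_inj_surj)
    then obtain u where "x = u\<^sup>2" by (metis surjD)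
    then show ?thesis using sq_mult by simp
  next
    case False
    define u v where "u = (x + 1) / 2" and "v = (x - 1) / 2"
    have "u + v = (2 * x) / 2" unfolding u_def v_def by (simp flip: add_divide_distrib)
    moreover have "u - v = 2 / 2" unfolding u_def v_def by (simp flip: diff_divide_distrib)
    moreover have "u\<^sup>2 - v\<^sup>2 = (u + v) * (u - v)" by (simp add: power2_eq_square algebra_simps)
    ultimately have x: "x = u\<^sup>2 - v\<^sup>2" using False by simp
    have "g (x * y) = g (u\<^sup>2 * y) - g (v\<^sup>2 * y)" by (simp add: x left_diff_distrib g_diff)
    then show ?thesis by (simp add: sq_mult x g_diff left_diff_distrib)
  qed
qed

theorem cyclotomic_similarity_semilinear:
  fixes l :: "'a::{field,finite} \<Rightarrow> 'a"
  assumes l: "cyclotomic_similarity m l" and mn: "m * n = CARD('a) - 1" "n \<ge> 2"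
  obtains \<sigma> where "\<sigma> \<in> carrier Galois" "\<And>x. l x = l 1 * \<sigma> x"
proof
  have m: "m > 0" using mn card_field_ge_2[where ?'a='a] by (cases m) auto
  let ?g = "\<lambda>x. l x / l 1" and ?h = "\<lambda>x. l 1 * inverse (l (inverse x))"
  have l1: "l 1 \<noteq> 0" using cyclotomic_similarity_eq_0_iff[OF l m] by simp
  have inj: "inj ?g" using cyclotomic_similarity_inj[OF l m] l1 by (auto simp: inj_on_def)
  have mult: "?g (x * y) = ?g x * ?g y" for x y
  proof (rule additive_inverse_additive_imp_mult[where h = ?h])
    show "?g (x + y) = ?g x + ?g y" for x y
      by (simp add: cyclotomic_similarity_additive[OF l mn] add_divide_distrib)
    show "?h (x + y) = ?h x + ?h y" for x y
      using cyclotomic_similarity_additive[OF cyclotomic_similarity_inverse[OF l m] mn]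
      by (simp add: distrib_left)
  qed (use inj l1 in \<open>simp_all add: field_simps\<close>)
  have "bij ?g" using inj by (intro bijI finite_UNIV_inj_surj) auto
  then show "?g \<in> carrier Galois"
    unfolding Galois_iff using mult l1 
    by (simp add: cyclotomic_similarity_additive[OF l mn] add_divide_distrib)
  show "l x = l 1 * ?g x" for x using l1 by simp
qed

section \<open>Vectors, determinants and classes modulo K\<close>

abbreviation vec2 :: "'a::zero \<Rightarrow> 'a \<Rightarrow> 'a^2" where
  "vec2 a b \<equiv> vector [a, b]"

lemma vec2_eq_0_iff: "vec2 a b = 0 \<longleftrightarrow> a = 0 \<and> b = 0"
  by (simp add: vec_eq_iff forall_2)

lemma det2_vec2: "det2 (vec2 a b) (vec2 c d) = a * d - c * b"
  by (simp add: det2_def)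

lemma det2_scale_left: "det2 (a *s u) v = a * det2 u v"
  and det2_scale_right: "det2 u (a *s v) = a * det2 u v"
  by (simp_all add: det2_def algebra_simps)

lemma det2_self: "det2 u u = 0"
  by (simp add: det2_def)

text \<open>
  Cramer's rule.
\<close>

lemma det2_coordinates:
  fixes p q w :: "'a::field^2"
  assumes "det2 p q \<noteq> 0"
  shows "w = (det2 w q / det2 p q) *s p + (det2 p w / det2 p q) *s q"
proof -
  have "det2 p q * w $ i = det2 w q * p $ i + det2 p w * q $ i" for i
    using exhaust_2[of i] by (auto simp: det2_def algebra_simps)
  then show ?thesis using assms by (simp add: vec_eq_iff field_simps)
qed

lemma det2_eq_0_imp_parallel:
  fixes u v :: "'a::field^2"
  assumes "det2 u v = 0" "u \<noteq> 0" "v \<noteq> 0"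
  obtains y where "y \<noteq> 0" "v = y *s u"
proof -
  obtain i where i: "u $ i \<noteq> 0" using assms by (auto simp: vec_eq_iff)
  have "u $ i * v $ j = v $ i * u $ j" for j
    using assms(1) exhaust_2[of i] exhaust_2[of j] by (auto simp: det2_def algebra_simps)
  then have v: "v = (v $ i / u $ i) *s u" using i by (simp add: vec_eq_iff field_simps)
  moreover have "v $ i / u $ i \<noteq> 0" using v assms(3) by (metis vector_smult_lzero)
  ultimately show thesis using that by blast
qed

lemma det2_matrix_vector: "det2 (T *v u) (T *v v) = det T * det2 u v"
  for T :: "'a::field^2^2"
  by (simp add: det2_def det_2 matrix_vector_mult_def sum_2 algebra_simps)

lemma det2_galois_vec:
  assumes "\<sigma> \<in> carrier Galois"
  shows "det2 (galois_vec \<sigma> u) (galois_vec \<sigma> v) = \<sigma> (det2 u v)"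
proof -
  have diff: "\<sigma> (x - y) = \<sigma> x - \<sigma> y" for x y
    using assms unfolding Galois_iff by (metis add_diff_cancel diff_add_cancel)
  show ?thesis using assms by (simp add: det2_def galois_vec_def diff Galois_iff)
qed

lemma galois_vec_scale:
  "\<sigma> \<in> carrier Galois \<Longrightarrow> galois_vec \<sigma> (a *s v) = \<sigma> a *s galois_vec \<sigma> v"
  by (simp add: galois_vec_def vec_eq_iff Galois_iff)

lemma Galois_nonzero: "\<sigma> \<in> carrier Galois \<Longrightarrow> x \<noteq> 0 \<Longrightarrow> \<sigma> x \<noteq> 0"
  using Galois_0[of \<sigma>] unfolding Galois_iff bij_def by (metis injD)

lemma Galois_surj:
  assumes "\<sigma> \<in> carrier Galois" "x \<noteq> 0"
  obtains y where "y \<noteq> 0" "x = \<sigma> y"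
  using assms Galois_0[OF assms(1)] unfolding Galois_iff bij_def by (metis surjD)

lemma mem_GL2_iff: "T \<in> carrier (GL2 :: ('a::field^2^2) monoid) \<longleftrightarrow> det T \<noteq> 0"
  by (simp add: GL2_def invertible_det_nz)

lemma mem_GammaL2_iff: "(T, \<sigma>) \<in> carrier GammaL2 \<longleftrightarrow> T \<in> carrier GL2 \<and> \<sigma> \<in> carrier Galois"
  by (simp add: GammaL2_def semidirect_def)

context
  fixes K :: "'a::{field,finite} set"
  assumes K: "subgroup K units_group"
begin

abbreviation coset :: "'a \<Rightarrow> 'a set" where
  "coset x \<equiv> K #>\<^bsub>units_group\<^esub> x"

lemma card_K_pos: "card K > 0"
  using K_one[OF K] by (auto simp: card_gt_0_iff)

lemma mem_K_iff: "x \<in> K \<longleftrightarrow> x ^ card K = 1"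
  using K_roots[OF K] by blast

text \<open>
  This translates between classes and the power map. It covers \<open>0\<close> too: the class of \<open>0\<close> is \<open>{0}\<close>.
\<close>

lemma coset_eq_iff: "coset x = coset y \<longleftrightarrow> x ^ card K = y ^ card K"
proof
  assume "coset x = coset y"
  moreover have "x \<in> coset x" using K_one[OF K] by (force simp: r_coset_K)
  ultimately obtain k where "k \<in> K" "x = k * y" by (auto simp: r_coset_K)
  then show "x ^ card K = y ^ card K" by (simp add: power_mult_distrib mem_K_iff)
next
  assume eq: "x ^ card K = y ^ card K"
  show "coset x = coset y"
  proof (cases "y = 0")
    case True
    then have "x = 0" using eq card_K_pos by (simp add: zero_power)
    then show ?thesis using True by simp
  next
    case False
    then have "x / y \<in> K" using eq by (simp add: mem_K_iff power_divide)
    from coset_absorb[OF K this, of y] show ?thesis using False by simp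
  qed
qed

lemma orb_eq_iff: "orb K u = orb K v \<longleftrightarrow> (\<exists>a\<in>K. u = a *s v)"
proof
  assume "orb K u = orb K v"
  moreover have "u \<in> orb K u" using K_one[OF K] by (force simp: orb_def)
  ultimately show "\<exists>a\<in>K. u = a *s v" by (auto simp: orb_def)
qed (auto simp: orb_absorb[OF K])

lemma orb_scale_cong:
  assumes "x ^ card K = y ^ card K"
  shows "orb K (x *s v) = orb K (y *s v)"
proof (cases "y = 0")
  case True
  then have "x = 0" using assms card_K_pos by (simp add: zero_power)
  then show ?thesis using True by simp
next
  case False
  then have "x / y \<in> K" using assms by (simp add: mem_K_iff power_divide)
  from orb_absorb[OF K this, of "y *s v"] show ?thesis using False by (simp add: vector_smult_assoc)
qed

lemma orb_scale_congD:
  assumes "orb K (x *s v) = orb K (y *s v)" "v \<noteq> 0"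
  shows "x ^ card K = y ^ card K"
proof -
  obtain a where a: "a \<in> K" "x *s v = a *s (y *s v)" using assms(1) orb_eq_iff by blast
  obtain i where "v $ i \<noteq> 0" using assms(2) by (auto simp: vec_eq_iff)
  moreover have "x * v $ i = a * y * v $ i"
    using arg_cong[OF a(2), of "\<lambda>w. w $ i"] by (simp add: mult.assoc)
  ultimately have "x = a * y" by simp
  then show ?thesis using a(1) by (simp add: power_mult_distrib mem_K_iff)
qed

lemma class_group_carrier: "carrier (class_group K) = {coset x | x. x \<noteq> 0}"
  by (auto simp: class_group_def FactGroup_def RCOSETS_def)

lemma \<Omega>_I: "v \<noteq> 0 \<Longrightarrow> orb K v \<in> \<Omega> K"
  by (auto simp: \<Omega>_def)

lemma mem_rel_r_iff:
  assumes "u \<noteq> 0" "v \<noteq> 0"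
  shows "(orb K u, orb K v) \<in> rel_r K (coset y) \<longleftrightarrow> orb K v = orb K (y *s u)"
  using assms by (simp add: rel_r_def cact_eq[OF K] \<Omega>_I)

lemma mem_rel_s_iff:
  assumes "u \<noteq> 0" "v \<noteq> 0"
  shows "(orb K u, orb K v) \<in> rel_s K (coset y) \<longleftrightarrow> det2 u v ^ card K = y ^ card K"
  using assms by (simp add: rel_s_def pairing_eq[OF K] \<Omega>_I coset_eq_iff)

section \<open>Class preserving maps of the plane are semilinear\<close>

text \<open>
  Here \<open>h\<close> chooses a representative of the image of each class. Relative to the images \<open>p\<close> and \<open>q\<close> of the basis
  vectors, the class of \<open>(1, t)\<close> goes to that of \<open>p + l t *s q\<close>: the coefficient of \<open>p\<close> lies in \<open>K\<close>, because
  the determinant with the second basis vector is \<open>1\<close> for all vectors \<open>(1, t)\<close>. The determinant of \<open>(1, a)\<close> and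
  \<open>(1, b)\<close> is \<open>b - a\<close>, so that \<open>l\<close> is a cyclotomic similarity. As \<open>h\<close> respects scalars up to classes, its
  values on the vectors \<open>(1, t)\<close> and \<open>(0, 1)\<close> determine it.
\<close>

theorem semilinear_if_preserves_classes:
  fixes h :: "'a^2 \<Rightarrow> 'a^2"
  assumes n: "card K * n = CARD('a) - 1" "n \<ge> 2"
    and scale: "\<And>y. y \<noteq> 0 \<Longrightarrow> \<exists>y'. \<forall>v. v \<noteq> 0 \<longrightarrow> orb K (h (y *s v)) = orb K (y' *s h v)"
    and dets: "\<And>u v u' v'. u \<noteq> 0 \<Longrightarrow> v \<noteq> 0 \<Longrightarrow> u' \<noteq> 0 \<Longrightarrow> v' \<noteq> 0 \<Longrightarrow>
      det2 (h u) (h v) ^ card K = det2 (h u') (h v') ^ card K \<longleftrightarrow>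
      det2 u v ^ card K = det2 u' v' ^ card K"
  obtains T \<sigma> where "(T, \<sigma>) \<in> carrier GammaL2"
    "\<And>v. v \<noteq> 0 \<Longrightarrow> orb K (h v) = orb K (T *v galois_vec \<sigma> v)"
proof -
  define N where "N x = x ^ card K" for x :: 'a
  have N_mult: "N (x * y) = N x * N y" for x y by (simp add: N_def power_mult_distrib)
  have N_1: "N 1 = 1" by (simp add: N_def)
  have N_eq_0: "N x = 0 \<longleftrightarrow> x = 0" for x using card_K_pos by (simp add: N_def)
  have dets': "N (det2 (h u) (h v)) = N (det2 (h u') (h v')) \<longleftrightarrow> N (det2 u v) = N (det2 u' v')"
    if "u \<noteq> 0" "v \<noteq> 0" "u' \<noteq> 0" "v' \<noteq> 0" for u v u' v'
    using dets[OF that] by (simp add: N_def)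
  let ?e1 = "vec2 1 0 :: 'a^2" and ?e2 = "vec2 0 1 :: 'a^2"
  define p q D where "p = h ?e1" and "q = h ?e2" and "D = det2 p q"
  have nz: "?e1 \<noteq> 0" "?e2 \<noteq> 0" "vec2 1 t \<noteq> 0" for t :: 'a by (simp_all add: vec2_eq_0_iff)
  have D0: "D \<noteq> 0"
    using dets'[of ?e1 ?e2 ?e1 ?e1] nz
    N_eq_0[of 0]
    by (auto simp: D_def p_def q_def det2_self det2_vec2 N_1)
  define \<xi> where "\<xi> t = det2 (h (vec2 1 t)) q / D" for t
  define l where "l t = det2 p (h (vec2 1 t)) / det2 (h (vec2 1 t)) q" for t
  have N_\<xi>: "N (\<xi> t) = 1" for t
  proof -
    have "N (det2 (h (vec2 1 t)) q) = N D"
      unfolding q_def D_def p_def using dets'[of "vec2 1 t" ?e2 ?e1 ?e2] nz by (simp add: det2_vec2)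
    moreover have "N (det2 (h (vec2 1 t)) q) = N (\<xi> t) * N D"
      using D0 by (simp add: \<xi>_def flip: N_mult)
    ultimately show ?thesis using D0 N_eq_0 by simp
  qed
  have \<xi>_nz: "\<xi> t \<noteq> 0" for t using N_\<xi>[of t] N_eq_0[of "\<xi> t"] by auto
  have h1: "h (vec2 1 t) = \<xi> t *s (p + l t *s q)" for t
  proof -
    have "\<xi> t * l t = det2 p (h (vec2 1 t)) / D" using \<xi>_nz[of t] D0 by (simp add: \<xi>_def l_def)
    then show ?thesis
      using det2_coordinates[of p q "h (vec2 1 t)"] D0
      by (simp add: \<xi>_def D_def vector_add_ldistrib vector_smult_assoc)
  qed
  have det_pq: "det2 (p + a *s q) (p + b *s q) = (b - a) * D" for a b
    by (simp add: det2_def D_def algebra_simps)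
  have N_h1: "N (det2 (h (vec2 1 a)) (h (vec2 1 b))) = N (l b - l a) * N D" for a b
    by (simp only: h1 det2_scale_left det2_scale_right det_pq N_mult N_\<xi> mult_1)
  have l0: "l 0 = 0" by (simp add: l_def p_def det2_self)
  have N_h1_p: "N (det2 p (h (vec2 1 b))) = N (l b) * N D" for b
    using N_h1[of 0 b] by (simp add: l0 p_def)
  have N_l_diff: "N (l b - l a) = N (l (b - a))" for a b
    using dets'[of "vec2 1 a" "vec2 1 b" "vec2 1 0" "vec2 1 (b - a)"] nz D0
    by (simp add: N_h1 det2_vec2 l0 N_eq_0)
  have N_l_eq: "N (l x) = N (l y) \<longleftrightarrow> N x = N y" for x y
    using dets'[of "vec2 1 0" "vec2 1 x" "vec2 1 0" "vec2 1 y"] nz D0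
    by (simp add: N_h1 det2_vec2 l0 N_eq_0)
  \<comment> \<open>The scalar by which multiplication with \<open>y\<close> is intertwined has the class of \<open>l y\<close>; it is computed from the
    determinants of \<open>(y, 0)\<close> with \<open>(0, 1)\<close> and of \<open>(1, 0)\<close> with \<open>(1, y)\<close>, both equal to \<open>y\<close>.\<close>
  have scale': "\<exists>y'. N y' = N (l y) \<and> (\<forall>v. v \<noteq> 0 \<longrightarrow> orb K (h (y *s v)) = orb K (y' *s h v))"
    if y: "y \<noteq> 0" for y
  proof -
    obtain y' where y': "\<And>v. v \<noteq> 0 \<Longrightarrow> orb K (h (y *s v)) = orb K (y' *s h v)"
      using scale[OF y] by blast
    obtain a where a: "a \<in> K" "h (y *s ?e1) = a *s (y' *s p)"
      using y'[of ?e1] nz unfolding orb_eq_iff p_def by blast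
    have "N (det2 (h (y *s ?e1)) q) = N y' * N D"
      using a(1) by (simp add: a det2_scale_left N_mult D_def mem_K_iff N_def power_mult_distrib)
    moreover have "N (det2 (h (y *s ?e1)) q) = N (det2 p (h (vec2 1 y)))"
      unfolding p_def q_def using dets'[of "y *s ?e1" ?e2 ?e1 "vec2 1 y"] nz y
      by (simp add: det2_vec2 det2_scale_left)
    ultimately have "N y' = N (l y)" using D0 by (simp add: N_h1_p N_eq_0)
    then show ?thesis using y' by blast
  qed
  have N_l_mult: "N (l (y * x)) = N (l y) * N (l x)" for x y
  proof (cases "y = 0")
    case False
    obtain y' where y': "N y' = N (l y)" "\<And>v. v \<noteq> 0 \<Longrightarrow> orb K (h (y *s v)) = orb K (y' *s h v)"
      using scale'[OF False] by blast
    obtain a where a: "a \<in> K" "h (y *s ?e1) = a *s (y' *s p)"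
      using y'(2)[of ?e1] nz unfolding orb_eq_iff p_def by blast
    have "N (l (y * x)) * N D = N (det2 p (h (vec2 1 (y * x))))" by (simp add: N_h1_p)
    \<comment> \<open>Both \<open>(1, 0), (1, y * x)\<close> and \<open>(y, 0), (1, x)\<close> have determinant \<open>y * x\<close>.\<close>
    also have "\<dots> = N (det2 (h (y *s ?e1)) (h (vec2 1 x)))"
      unfolding p_def using dets'[of ?e1 "vec2 1 (y * x)" "y *s ?e1" "vec2 1 x"] nz False
      by (simp add: det2_vec2 det2_scale_left)
    also have "\<dots> = N a * N y' * N (det2 p (h (vec2 1 x)))"
      by (simp add: a det2_scale_left N_mult)
    also have "N a = 1" using a(1) by (simp add: N_def mem_K_iff)
    finally show ?thesis using D0 by (simp add: N_h1_p y' N_eq_0)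
  qed (simp add: l0 N_mult N_eq_0)
  have "cyclotomic_similarity (card K) l"
    unfolding cyclotomic_similarity_def
    using l0 N_l_diff N_l_eq N_l_mult unfolding N_def by blast
  from cyclotomic_similarity_semilinear[OF this n] cyclotomic_similarity_one[OF this card_K_pos]
  obtain \<sigma> c where \<sigma>: "\<sigma> \<in> carrier Galois" "\<And>x. l x = c * \<sigma> x" and c: "N c = 1"
    unfolding N_def by metis
  define T :: "'a^2^2" where "T = (\<chi> i j. if j = 1 then p $ i else c * q $ i)"
  have T_mult: "T *v galois_vec \<sigma> v = \<sigma> (v $ 1) *s p + (c * \<sigma> (v $ 2)) *s q" for v
    by (simp add: T_def matrix_vector_mult_def galois_vec_def vec_eq_iff sum_2 algebra_simps)
  have "det T = c * D" by (simp add: det_2 T_def D_def det2_def algebra_simps)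
  then have T: "T \<in> carrier GL2" using c D0 N_eq_0[of c] by (auto simp: mem_GL2_iff)
  have "orb K (h v) = orb K (T *v galois_vec \<sigma> v)" if v: "v \<noteq> 0" for v
  proof (cases "v $ 1 = 0")
    case True
    have v2: "v $ 2 \<noteq> 0" using v True by (auto simp: vec_eq_iff forall_2)
    have v_eq: "v = (v $ 2) *s ?e2" using True by (simp add: vec_eq_iff forall_2)
    obtain y' where y': "N y' = N (l (v $ 2))" "\<And>w. w \<noteq> 0 \<Longrightarrow> orb K (h ((v $ 2) *s w)) = orb K (y' *s h w)"
      using scale'[OF v2] by blast
    have "orb K (h v) = orb K (y' *s q)" using y'(2)[OF nz(2)] v_eq by (simp add: q_def)
    also have "\<dots> = orb K ((c * \<sigma> (v $ 2)) *s q)"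
      using y'(1) by (intro orb_scale_cong) (simp add: \<sigma>(2) N_def)
    finally show ?thesis using True Galois_0[OF \<sigma>(1)] by (simp add: T_mult)
  next
    case False
    define t where "t = v $ 2 / v $ 1"
    have v_eq: "v = (v $ 1) *s vec2 1 t" using False by (simp add: vec_eq_iff forall_2 t_def)
    obtain y' where y': "N y' = N (l (v $ 1))" "\<And>w. w \<noteq> 0 \<Longrightarrow> orb K (h ((v $ 1) *s w)) = orb K (y' *s h w)"
      using scale'[OF False] by blast
    have "orb K (h v) = orb K (y' *s h (vec2 1 t))" using y'(2)[OF nz(3)] v_eq by metis
    also have "\<dots> = orb K ((y' * \<xi> t) *s (p + l t *s q))" by (simp only: h1 vector_smult_assoc)
    also have "\<dots> = orb K (\<sigma> (v $ 1) *s (p + l t *s q))"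
    proof (rule orb_scale_cong)
      have "N (y' * \<xi> t) = N (\<sigma> (v $ 1))" by (simp add: N_mult y' N_\<xi> \<sigma>(2) c)
      then show "(y' * \<xi> t) ^ card K = \<sigma> (v $ 1) ^ card K" by (simp add: N_def)
    qed
    also have "\<sigma> (v $ 1) *s (p + l t *s q) = T *v galois_vec \<sigma> v"
    proof -
      have "\<sigma> (v $ 1) * \<sigma> t = \<sigma> (v $ 1 * t)" using \<sigma>(1) by (simp add: Galois_iff)
      also have "v $ 1 * t = v $ 2" using False by (simp add: t_def)
      finally have "\<sigma> (v $ 1) * l t = c * \<sigma> (v $ 2)" by (simp add: \<sigma>(2) mult.left_commute)
      then show ?thesis by (simp add: T_mult vector_add_ldistrib vector_smult_assoc)
    qed
    finally show ?thesis .
  qed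
  then show thesis using that[of T \<sigma>] T \<sigma>(1) by (simp add: mem_GammaL2_iff)
qed

end

section \<open>Images of the basic relations\<close>

lemma rel_image_eqI:
  assumes f: "bij_betw f A A" and R: "R \<subseteq> A \<times> A" and R': "R' \<subseteq> A \<times> A"
    and iff: "\<And>\<alpha> \<beta>. \<alpha> \<in> A \<Longrightarrow> \<beta> \<in> A \<Longrightarrow> (\<alpha>, \<beta>) \<in> R \<longleftrightarrow> (f \<alpha>, f \<beta>) \<in> R'"
  shows "rel_image f R = R'"
proof
  show "rel_image f R \<subseteq> R'" using R iff by (auto simp: rel_image_def)
  show "R' \<subseteq> rel_image f R"
  proof (rule subrelI)
    fix a b assume ab: "(a, b) \<in> R'"
    then have "a \<in> A" "b \<in> A" using R' by auto
    then obtain \<alpha> \<beta> where "\<alpha> \<in> A" "\<beta> \<in> A" "a = f \<alpha>" "b = f \<beta>"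
      using f by (metis bij_betw_imp_surj_on imageE)
    then show "(a, b) \<in> rel_image f R" using iff ab by (auto simp: rel_image_def)
  qed
qed

lemma mem_rel_image_iff:
  assumes f: "inj_on f A" and R: "R \<subseteq> A \<times> A" and "\<alpha> \<in> A" "\<beta> \<in> A"
  shows "(f \<alpha>, f \<beta>) \<in> rel_image f R \<longleftrightarrow> (\<alpha>, \<beta>) \<in> R"
proof
  assume "(f \<alpha>, f \<beta>) \<in> rel_image f R"
  then obtain a b where ab: "(a, b) \<in> R" "f \<alpha> = f a" "f \<beta> = f b" by (auto simp: rel_image_def)
  then have "\<alpha> = a" "\<beta> = b" using R assms(3,4) inj_onD[OF f] by blast+
  then show "(\<alpha>, \<beta>) \<in> R" using ab by simp
qed (auto simp: rel_image_def)

lemma single_valued_rel_image_iff: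
  assumes f: "inj_on f A" and R: "R \<subseteq> A \<times> A"
  shows "single_valued (rel_image f R) \<longleftrightarrow> single_valued R"
proof
  assume sv: "single_valued (rel_image f R)"
  show "single_valued R"
  proof (rule single_valuedI)
    fix x y z assume xyz: "(x, y) \<in> R" "(x, z) \<in> R"
    then have "(f x, f y) \<in> rel_image f R" "(f x, f z) \<in> rel_image f R" by (auto simp: rel_image_def)
    then have "f y = f z" using sv by (rule single_valuedD[rotated])
    then show "y = z" using xyz R inj_onD[OF f] by blast
  qed
next
  assume sv: "single_valued R"
  show "single_valued (rel_image f R)"
  proof (rule single_valuedI)
    fix x y z assume "(x, y) \<in> rel_image f R" "(x, z) \<in> rel_image f R"
    then obtain a b c d where ab: "(a, b) \<in> R" "x = f a" "y = f b" and cd: "(c, d) \<in> R" "x = f c" "z = f d"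
      by (auto simp: rel_image_def)
    then have "a = c" using R inj_onD[OF f, of a c] by auto
    then show "y = z" using ab cd sv by (auto dest: single_valuedD)
  qed
qed

context
  fixes K :: "'a::{field,finite} set"
  assumes K: "subgroup K units_group"
begin

lemma S0_eq:
  "S0 K = {rel_r K (coset K y) | y. y \<noteq> 0} \<union> {rel_s K (coset K y) | y. y \<noteq> 0}"
  unfolding S0_def class_group_carrier[OF K] by blast

lemma rel_r_S0: "y \<noteq> 0 \<Longrightarrow> rel_r K (coset K y) \<in> S0 K"
  and rel_s_S0: "y \<noteq> 0 \<Longrightarrow> rel_s K (coset K y) \<in> S0 K"
  unfolding S0_eq by blast+

lemma rel_subsets: "rel_r K g \<subseteq> \<Omega> K \<times> \<Omega> K" "rel_s K g \<subseteq> \<Omega> K \<times> \<Omega> K"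
  by (auto simp: rel_r_def rel_s_def)

lemma single_valued_rel_r: "single_valued (rel_r K g)"
  by (auto simp: rel_r_def single_valued_def)

text \<open>
  For fixed \<open>y\<close>, all vectors \<open>(z, y)\<close> have determinant \<open>y\<close> with \<open>(1, 0)\<close>, and they lie in different classes.
\<close>

lemma not_single_valued_rel_s:
  assumes "y \<noteq> 0"
  shows "\<not> single_valued (rel_s K (coset K y))"
proof
  assume sv: "single_valued (rel_s K (coset K y))"
  have nz: "vec2 1 0 \<noteq> (0 :: 'a^2)" "vec2 z y \<noteq> 0" for z
    using assms by (simp_all add: vec2_eq_0_iff)
  have mem: "(orb K (vec2 1 0), orb K (vec2 z y)) \<in> rel_s K (coset K y)" for z
    unfolding mem_rel_s_iff[OF K nz] by (simp add: det2_vec2)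
  have "orb K (vec2 0 y) = orb K (vec2 1 y)"
    by (rule single_valuedD[OF sv mem mem])
  then obtain a where a: "vec2 0 y = a *s vec2 1 y" unfolding orb_eq_iff[OF K] by blast
  have "a = 0" using arg_cong[OF a, of "\<lambda>v :: 'a^2. v $ 1"] by simp
  then show False using arg_cong[OF a, of "\<lambda>v :: 'a^2. v $ 2"] assms by simp
qed

lemma rel_r_inj:
  assumes x: "x \<noteq> 0" and eq: "rel_r K (coset K x) = rel_r K (coset K y)"
  shows "coset K x = coset K y"
proof -
  let ?e = "vec2 1 0 :: 'a^2"
  have e: "?e \<noteq> 0" "x *s ?e \<noteq> 0" using x by (simp_all add: vec_eq_iff forall_2)
  have "(orb K ?e, orb K (x *s ?e)) \<in> rel_r K (coset K x)"
    unfolding mem_rel_r_iff[OF K e] by (rule refl)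
  then have "orb K (x *s ?e) = orb K (y *s ?e)" unfolding eq mem_rel_r_iff[OF K e] .
  from orb_scale_congD[OF K this e(1)] show ?thesis unfolding coset_eq_iff[OF K] .
qed

lemma rel_s_inj:
  assumes x: "x \<noteq> 0" and eq: "rel_s K (coset K x) = rel_s K (coset K y)"
  shows "coset K x = coset K y"
proof -
  let ?u = "vec2 1 0 :: 'a^2" and ?v = "vec2 0 x"
  have nz: "?u \<noteq> 0" "?v \<noteq> 0" using x by (simp_all add: vec2_eq_0_iff)
  have det: "det2 ?u ?v = x" by (simp add: det2_vec2)
  have "(orb K ?u, orb K ?v) \<in> rel_s K (coset K x)"
    unfolding mem_rel_s_iff[OF K nz] det by (rule refl)
  then show ?thesis unfolding eq mem_rel_s_iff[OF K nz] det coset_eq_iff[OF K] .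
qed

lemma gl_action_Bij: "x \<in> carrier GammaL2 \<Longrightarrow> gl_action K x \<in> Bij (\<Omega> K)"
  using gl_action_GammaL2[OF K] by (auto simp: hom_def BijGroup_def)

lemma bij_gl_action: "x \<in> carrier GammaL2 \<Longrightarrow> bij_betw (gl_action K x) (\<Omega> K) (\<Omega> K)"
  using gl_action_Bij by (simp add: Bij_def)

lemma rel_image_gl_action_r:
  assumes x: "(T, \<sigma>) \<in> carrier GammaL2" and y: "y \<noteq> 0"
  shows "rel_image (gl_action K (T, \<sigma>)) (rel_r K (coset K y)) = rel_r K (coset K (\<sigma> y))"
proof (rule rel_image_eqI[OF bij_gl_action[OF x] rel_subsets(1) rel_subsets(1)])
  have T: "T \<in> carrier GL2" and \<sigma>: "\<sigma> \<in> carrier Galois" using x by (simp_all add: mem_GammaL2_iff)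
  fix \<alpha> \<beta> assume "\<alpha> \<in> \<Omega> K" "\<beta> \<in> \<Omega> K"
  then obtain u v where u: "\<alpha> = orb K u" "u \<noteq> 0" and v: "\<beta> = orb K v" "v \<noteq> 0" by (auto simp: \<Omega>_def)
  have yu: "y *s u \<noteq> 0" using y u by (simp add: vec_eq_iff)
  have "(\<alpha>, \<beta>) \<in> rel_r K (coset K y) \<longleftrightarrow> orb K v = orb K (y *s u)"
    using u v by (simp add: mem_rel_r_iff[OF K])
  also have "\<dots> \<longleftrightarrow> gl_action K (T, \<sigma>) (orb K v) = gl_action K (T, \<sigma>) (orb K (y *s u))"
    using bij_gl_action[OF x] \<Omega>_I[OF K v(2)] \<Omega>_I[OF K yu] by (auto simp: bij_betw_def inj_on_def)
  also have "\<dots> \<longleftrightarrow> orb K (T *v galois_vec \<sigma> v) = orb K (\<sigma> y *s (T *v galois_vec \<sigma> u))"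
    using v yu by (simp add: gl_action_eq[OF K \<sigma>] galois_vec_scale[OF \<sigma>] vector_scalar_commute)
  also have "\<dots> \<longleftrightarrow> (gl_action K (T, \<sigma>) \<alpha>, gl_action K (T, \<sigma>) \<beta>) \<in> rel_r K (coset K (\<sigma> y))"
    using u v semilinear_nz[OF T \<sigma>] by (simp add: gl_action_eq[OF K \<sigma>] mem_rel_r_iff[OF K])
  finally show "(\<alpha>, \<beta>) \<in> rel_r K (coset K y) \<longleftrightarrow>
    (gl_action K (T, \<sigma>) \<alpha>, gl_action K (T, \<sigma>) \<beta>) \<in> rel_r K (coset K (\<sigma> y))" .
qed

lemma rel_image_gl_action_s:
  assumes x: "(T, \<sigma>) \<in> carrier GammaL2" and y: "y \<noteq> 0"
  shows "rel_image (gl_action K (T, \<sigma>)) (rel_s K (coset K y)) = rel_s K (coset K (det T * \<sigma> y))"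
proof (rule rel_image_eqI[OF bij_gl_action[OF x] rel_subsets(2) rel_subsets(2)])
  have T: "T \<in> carrier GL2" and \<sigma>: "\<sigma> \<in> carrier Galois" using x by (simp_all add: mem_GammaL2_iff)
  have inj: "\<sigma> a = \<sigma> b \<longleftrightarrow> a = b" for a b
    using \<sigma> unfolding Galois_iff bij_def by (auto dest: injD)
  fix \<alpha> \<beta> assume "\<alpha> \<in> \<Omega> K" "\<beta> \<in> \<Omega> K"
  then obtain u v where u: "\<alpha> = orb K u" "u \<noteq> 0" and v: "\<beta> = orb K v" "v \<noteq> 0" by (auto simp: \<Omega>_def)
  have "(\<alpha>, \<beta>) \<in> rel_s K (coset K y) \<longleftrightarrow> \<sigma> (det2 u v ^ card K) = \<sigma> (y ^ card K)"
    using u v by (simp add: mem_rel_s_iff[OF K] inj)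
  also have "\<dots> \<longleftrightarrow> (det T * \<sigma> (det2 u v)) ^ card K = (det T * \<sigma> y) ^ card K"
    using T by (simp add: Galois_power[OF \<sigma>] power_mult_distrib mem_GL2_iff)
  also have "\<dots> \<longleftrightarrow> (gl_action K (T, \<sigma>) \<alpha>, gl_action K (T, \<sigma>) \<beta>) \<in> rel_s K (coset K (det T * \<sigma> y))"
    using u v semilinear_nz[OF T \<sigma>]
    by (simp add: gl_action_eq[OF K \<sigma>] mem_rel_s_iff[OF K] det2_matrix_vector det2_galois_vec[OF \<sigma>])
  finally show "(\<alpha>, \<beta>) \<in> rel_s K (coset K y) \<longleftrightarrow>
    (gl_action K (T, \<sigma>) \<alpha>, gl_action K (T, \<sigma>) \<beta>) \<in> rel_s K (coset K (det T * \<sigma> y))" .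
qed

lemma gl_action_Iso:
  assumes x: "x \<in> carrier GammaL2"
  shows "gl_action K x \<in> Iso (\<Omega> K) (S0 K)"
proof -
  obtain T \<sigma> where x_eq: "x = (T, \<sigma>)" and T: "det T \<noteq> 0" and \<sigma>: "\<sigma> \<in> carrier Galois"
    using x by (cases x) (auto simp: mem_GammaL2_iff mem_GL2_iff)
  note im = rel_image_gl_action_r[OF x[unfolded x_eq]] rel_image_gl_action_s[OF x[unfolded x_eq]]
  have "{rel_image (gl_action K x) s | s. s \<in> S0 K} = S0 K"
  proof (intro equalityI subsetI)
    fix R assume "R \<in> {rel_image (gl_action K x) s | s. s \<in> S0 K}"
    then obtain s where s: "s \<in> S0 K" "R = rel_image (gl_action K x) s" by blast
    from s(1) consider y where "y \<noteq> 0" "s = rel_r K (coset K y)" | y where "y \<noteq> 0" "s = rel_s K (coset K y)"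
      unfolding S0_eq by blast
    then show "R \<in> S0 K"
    proof cases
      case (1 y)
      then show ?thesis using rel_r_S0[OF Galois_nonzero[OF \<sigma> 1(1)]] by (simp add: s(2) x_eq im)
    next
      case (2 y)
      then have "det T * \<sigma> y \<noteq> 0" using Galois_nonzero[OF \<sigma>] T by simp
      from rel_s_S0[OF this] show ?thesis using 2 by (simp add: s(2) x_eq im)
    qed
  next
    fix R assume "R \<in> S0 K"
    then consider y where "y \<noteq> 0" "R = rel_r K (coset K y)" | y where "y \<noteq> 0" "R = rel_s K (coset K y)"
      unfolding S0_eq by blast
    then show "R \<in> {rel_image (gl_action K x) s | s. s \<in> S0 K}"
    proof cases
      case (1 y)
      obtain z where z: "z \<noteq> 0" "y = \<sigma> z" using Galois_surj[OF \<sigma> 1(1)] .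
      then show ?thesis using 1 rel_r_S0[OF z(1)] im(1)[OF z(1)] unfolding x_eq by blast
    next
      case (2 y)
      have "y / det T \<noteq> 0" using 2(1) T by simp
      then obtain z where z: "z \<noteq> 0" "y / det T = \<sigma> z" using Galois_surj[OF \<sigma>] by blast
      then have "y = det T * \<sigma> z" using T by (simp add: field_simps)
      then show ?thesis using 2 rel_s_S0[OF z(1)] im(2)[OF z(1)] unfolding x_eq by blast
    qed
  qed
  then show ?thesis using gl_action_Bij[OF x] by (simp add: Iso_def BijGroup_def)
qed

section \<open>Isomorphisms and automorphisms of the scheme\<close>

text \<open>
  Being single-valued is invariant under permutations and separates the relations \<open>r\<close> from the relations \<open>s\<close>,
  so \<open>f\<close> permutes each family. The images of the relations \<open>r\<close> give the compatibility with scalars, and those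
  of the relations \<open>s\<close> the compatibility with nonzero determinants; a zero determinant means that the vectors are proportional,
  which is again a matter of scalars.
\<close>

lemma Iso_imp_gl_action:
  assumes n: "card K * n = CARD('a) - 1" "n \<ge> 2" and f: "f \<in> Iso (\<Omega> K) (S0 K)"
  shows "\<exists>x\<in>carrier GammaL2. f = gl_action K x"
proof -
  have f_Bij: "f \<in> Bij (\<Omega> K)" and f_S0: "{rel_image f s | s. s \<in> S0 K} = S0 K"
    using f by (simp_all add: Iso_def BijGroup_def)
  have bij: "bij_betw f (\<Omega> K) (\<Omega> K)" and ext: "f \<in> extensional (\<Omega> K)"
    using f_Bij by (auto simp: Bij_def)
  have inj: "inj_on f (\<Omega> K)" using bij by (simp add: bij_betw_def)
  have "\<forall>v. \<exists>w. v \<noteq> 0 \<longrightarrow> w \<noteq> 0 \<and> f (orb K v) = orb K w"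
  proof
    fix v :: "'a^2"
    show "\<exists>w. v \<noteq> 0 \<longrightarrow> w \<noteq> 0 \<and> f (orb K v) = orb K w"
    proof (cases "v = 0")
      case False
      then have "f (orb K v) \<in> \<Omega> K" using bij_betwE[OF bij] \<Omega>_I[OF K] by blast
      then show ?thesis unfolding \<Omega>_def by blast
    qed simp
  qed
  from choice[OF this] obtain h where "\<forall>v. v \<noteq> 0 \<longrightarrow> h v \<noteq> 0 \<and> f (orb K v) = orb K (h v)" ..
  then have h_nz: "\<And>v. v \<noteq> 0 \<Longrightarrow> h v \<noteq> 0" and h: "\<And>v. v \<noteq> 0 \<Longrightarrow> f (orb K v) = orb K (h v)"
    by blast+
  have S0_image: "(\<exists>y'. y' \<noteq> 0 \<and> rel_image f R = rel_r K (coset K y')) \<or>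
      (\<exists>y'. y' \<noteq> 0 \<and> rel_image f R = rel_s K (coset K y'))" if "R \<in> S0 K" for R
  proof -
    have "rel_image f R \<in> S0 K" using that f_S0 by blast
    then show ?thesis unfolding S0_eq by blast
  qed
  have image_r: "\<exists>y'. y' \<noteq> 0 \<and> rel_image f (rel_r K (coset K y)) = rel_r K (coset K y')" if y: "y \<noteq> 0" for y
  proof -
    have sv: "single_valued (rel_image f (rel_r K (coset K y)))"
      unfolding single_valued_rel_image_iff[OF inj rel_subsets(1)] by (rule single_valued_rel_r)
    have "rel_image f (rel_r K (coset K y)) \<noteq> rel_s K (coset K y')" if "y' \<noteq> 0" for y'
      using not_single_valued_rel_s[OF that] sv by metis
    then show ?thesis using S0_image[OF rel_r_S0[OF y]] by blast
  qed
  have image_s: "\<exists>y'. y' \<noteq> 0 \<and> rel_image f (rel_s K (coset K y)) = rel_s K (coset K y')" if y: "y \<noteq> 0" for y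
  proof -
    have nsv: "\<not> single_valued (rel_image f (rel_s K (coset K y)))"
      unfolding single_valued_rel_image_iff[OF inj rel_subsets(2)] by (rule not_single_valued_rel_s[OF y])
    have "rel_image f (rel_s K (coset K y)) \<noteq> rel_r K (coset K y')" for y'
      using single_valued_rel_r[of "coset K y'"] nsv by metis
    then show ?thesis using S0_image[OF rel_s_S0[OF y]] by blast
  qed
  have scale: "\<exists>y'. y' \<noteq> 0 \<and> (\<forall>v. v \<noteq> 0 \<longrightarrow> orb K (h (y *s v)) = orb K (y' *s h v))" if y: "y \<noteq> 0" for y
  proof -
    obtain y' where y': "y' \<noteq> 0" "rel_image f (rel_r K (coset K y)) = rel_r K (coset K y')"
      using image_r[OF y] by blast
    have "orb K (h (y *s v)) = orb K (y' *s h v)" if v: "v \<noteq> 0" for v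
    proof -
      have yv: "y *s v \<noteq> 0" using y v by (simp add: vec_eq_iff)
      have "(orb K v, orb K (y *s v)) \<in> rel_r K (coset K y)" by (simp add: mem_rel_r_iff[OF K v yv])
      then have "(f (orb K v), f (orb K (y *s v))) \<in> rel_r K (coset K y')"
        unfolding y'(2)[symmetric] rel_image_def by blast
      then show ?thesis using v yv h_nz by (simp add: h mem_rel_r_iff[OF K])
    qed
    then show ?thesis using y'(1) by blast
  qed
  have det_class: "\<exists>z. z \<noteq> 0 \<and> (\<forall>u v. u \<noteq> 0 \<longrightarrow> v \<noteq> 0 \<longrightarrow>
      (det2 (h u) (h v) ^ card K = z ^ card K \<longleftrightarrow> det2 u v ^ card K = y ^ card K))" if y: "y \<noteq> 0" for y
  proof -
    obtain z where z: "z \<noteq> 0" "rel_image f (rel_s K (coset K y)) = rel_s K (coset K z)"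
      using image_s[OF y] by blast
    have "det2 (h u) (h v) ^ card K = z ^ card K \<longleftrightarrow> det2 u v ^ card K = y ^ card K"
      if uv: "u \<noteq> 0" "v \<noteq> 0" for u v
      using mem_rel_image_iff[OF inj rel_subsets(2) \<Omega>_I[OF K uv(1)] \<Omega>_I[OF K uv(2)], of "coset K y"]
      unfolding z(2) h[OF uv(1)] h[OF uv(2)] mem_rel_s_iff[OF K uv] mem_rel_s_iff[OF K h_nz[OF uv(1)] h_nz[OF uv(2)]] .
    then show ?thesis using z(1) by blast
  qed
  have det_0: "det2 (h u) (h v) = 0 \<longleftrightarrow> det2 u v = 0" if uv: "u \<noteq> 0" "v \<noteq> 0" for u v
  proof
    assume "det2 u v = 0"
    from this uv obtain y where y: "y \<noteq> 0" "v = y *s u" by (rule det2_eq_0_imp_parallel)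
    obtain y' where "orb K (h (y *s u)) = orb K (y' *s h u)" using scale[OF y(1)] uv(1) by blast
    then obtain a where "h (y *s u) = a *s (y' *s h u)" unfolding orb_eq_iff[OF K] by blast
    then show "det2 (h u) (h v) = 0" unfolding y(2) by (simp add: det2_scale_right det2_self)
  next
    assume 0: "det2 (h u) (h v) = 0"
    show "det2 u v = 0"
    proof (rule ccontr)
      assume nz: "det2 u v \<noteq> 0"
      obtain z where "z \<noteq> 0" "det2 (h u) (h v) ^ card K = z ^ card K"
        using det_class[OF nz] uv by blast
      then show False unfolding 0 zero_power[OF card_K_pos[OF K]] by simp
    qed
  qed
  have dets: "det2 (h u) (h v) ^ card K = det2 (h u') (h v') ^ card K \<longleftrightarrow>
      det2 u v ^ card K = det2 u' v' ^ card K"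
    if nz: "u \<noteq> 0" "v \<noteq> 0" "u' \<noteq> 0" "v' \<noteq> 0" for u v u' v'
  proof (cases "det2 u v = 0")
    case True
    have "det2 (h u) (h v) = 0" unfolding det_0[OF nz(1,2)] by (rule True)
    moreover have "0 = x ^ card K \<longleftrightarrow> x = 0" for x :: 'a
      using card_K_pos[OF K] by auto
    ultimately show ?thesis by (simp only: True zero_power[OF card_K_pos[OF K]] det_0[OF nz(3,4)])
  next
    case False
    then obtain z where "\<And>u' v'. u' \<noteq> 0 \<Longrightarrow> v' \<noteq> 0 \<Longrightarrow>
        det2 (h u') (h v') ^ card K = z ^ card K \<longleftrightarrow> det2 u' v' ^ card K = det2 u v ^ card K"
      using det_class[OF False] by blast
    from this[OF nz(1,2)] this[OF nz(3,4)] show ?thesis by (metis (full_types))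
  qed
  have scale': "\<exists>y'. \<forall>v. v \<noteq> 0 \<longrightarrow> orb K (h (y *s v)) = orb K (y' *s h v)" if "y \<noteq> 0" for y
    using scale[OF that] by blast
  obtain T \<sigma> where T\<sigma>: "(T, \<sigma>) \<in> carrier GammaL2"
    and orb_h: "\<And>v. v \<noteq> 0 \<Longrightarrow> orb K (h v) = orb K (T *v galois_vec \<sigma> v)"
  proof (rule semilinear_if_preserves_classes[OF K n, of h])
    fix T \<sigma>
    assume "(T, \<sigma>) \<in> carrier GammaL2"
      and "\<And>v. v \<noteq> 0 \<Longrightarrow> orb K (h v) = orb K (T *v galois_vec \<sigma> v)"
    then show thesis by (rule that)
  next
    fix y :: 'a assume "y \<noteq> 0"
    then show "\<exists>y'. \<forall>v. v \<noteq> 0 \<longrightarrow> orb K (h (y *s v)) = orb K (y' *s h v)" by (rule scale')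
  next
    fix u v u' v' :: "'a^2" assume nz: "u \<noteq> 0" "v \<noteq> 0" "u' \<noteq> 0" "v' \<noteq> 0"
    show "det2 (h u) (h v) ^ card K = det2 (h u') (h v') ^ card K \<longleftrightarrow>
      det2 u v ^ card K = det2 u' v' ^ card K" by (rule dets[OF nz])
  qed
  have "f = gl_action K (T, \<sigma>)"
  proof (rule extensionalityI[OF ext])
    show "gl_action K (T, \<sigma>) \<in> extensional (\<Omega> K)" using gl_action_Bij[OF T\<sigma>] by (simp add: Bij_def)
    fix \<alpha> assume "\<alpha> \<in> \<Omega> K"
    then obtain v where v: "\<alpha> = orb K v" "v \<noteq> 0" by (auto simp: \<Omega>_def)
    have "\<sigma> \<in> carrier Galois" using T\<sigma> by (simp add: mem_GammaL2_iff)
    then show "f \<alpha> = gl_action K (T, \<sigma>) \<alpha>"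
      unfolding v(1) h[OF v(2)] orb_h[OF v(2)] by (rule gl_action_eq[OF K _ v(2), symmetric])
  qed
  then show ?thesis using T\<sigma> by blast
qed

lemma mem_GL2_K_Galois0_iff:
  "(T, \<sigma>) \<in> carrier (GL2_K_Galois0 K) \<longleftrightarrow>
    (T, \<sigma>) \<in> carrier GammaL2 \<and> det T \<in> K \<and> (\<forall>x. x \<noteq> 0 \<longrightarrow> coset K (\<sigma> x) = coset K x)"
proof -
  have "galois_C K \<sigma> = (\<lambda>c\<in>carrier (class_group K). c) \<longleftrightarrow> (\<forall>x. x \<noteq> 0 \<longrightarrow> coset K (\<sigma> x) = coset K x)"
    if \<sigma>: "\<sigma> \<in> carrier Galois"
  proof
    assume eq: "galois_C K \<sigma> = (\<lambda>c\<in>carrier (class_group K). c)"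
    show "\<forall>x. x \<noteq> 0 \<longrightarrow> coset K (\<sigma> x) = coset K x"
    proof (intro allI impI)
      fix x :: 'a assume x: "x \<noteq> 0"
      have "coset K x \<in> carrier (class_group K)" using x by (auto simp: class_group_carrier[OF K])
      then show "coset K (\<sigma> x) = coset K x" using fun_cong[OF eq, of "coset K x"] galois_C_eq[OF K \<sigma> x] by simp
    qed
  next
    assume eq: "\<forall>x. x \<noteq> 0 \<longrightarrow> coset K (\<sigma> x) = coset K x"
    show "galois_C K \<sigma> = (\<lambda>c\<in>carrier (class_group K). c)"
    proof
      fix c
      show "galois_C K \<sigma> c = (\<lambda>c\<in>carrier (class_group K). c) c"
      proof (cases "c \<in> carrier (class_group K)")
        case True
        then obtain x where x: "x \<noteq> 0" "c = coset K x" by (auto simp: class_group_carrier[OF K])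
        then show ?thesis using True galois_C_eq[OF K \<sigma> x(1)] eq by simp
      qed (simp add: galois_C_def)
    qed
  qed
  then show ?thesis
    by (auto simp: GL2_K_Galois0_def GL2_K_def Galois0_def semidirect_def kernel_def BijGroup_def mem_GammaL2_iff)
qed

text \<open>
  The relation at a class determines the class, so fixing all relations means \<open>K \<sigma>(y) = K y\<close> and
  \<open>K det T \<sigma>(y) = K y\<close> for all \<open>y\<close>.
\<close>

lemma gl_action_Aut_iff:
  assumes x: "(T, \<sigma>) \<in> carrier GammaL2"
  shows "gl_action K (T, \<sigma>) \<in> Aut (\<Omega> K) (S0 K) \<longleftrightarrow> (T, \<sigma>) \<in> carrier (GL2_K_Galois0 K)"
proof -
  have \<sigma>: "\<sigma> \<in> carrier Galois" and T: "det T \<noteq> 0"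
    using x by (simp_all add: mem_GammaL2_iff mem_GL2_iff)
  note im = rel_image_gl_action_r[OF x] rel_image_gl_action_s[OF x]
  have coset_det: "coset K (det T * y) = coset K y \<longleftrightarrow> det T \<in> K" if "y \<noteq> 0" for y
    using that by (simp add: coset_eq_iff[OF K] mem_K_iff[OF K] power_mult_distrib)
  have ball_S0: "(\<forall>s\<in>S0 K. P s) \<longleftrightarrow>
      (\<forall>y. y \<noteq> 0 \<longrightarrow> P (rel_r K (coset K y))) \<and> (\<forall>y. y \<noteq> 0 \<longrightarrow> P (rel_s K (coset K y)))" for P
    unfolding S0_eq by blast
  have "gl_action K (T, \<sigma>) \<in> Aut (\<Omega> K) (S0 K) \<longleftrightarrow>
      (\<forall>s\<in>S0 K. rel_image (gl_action K (T, \<sigma>)) s = s)"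
    using gl_action_Bij[OF x] unfolding Aut_def BijGroup_def by simp
  also have "\<dots> \<longleftrightarrow>
      (\<forall>y. y \<noteq> 0 \<longrightarrow> rel_r K (coset K (\<sigma> y)) = rel_r K (coset K y)) \<and>
      (\<forall>y. y \<noteq> 0 \<longrightarrow> rel_s K (coset K (det T * \<sigma> y)) = rel_s K (coset K y))"
    unfolding ball_S0
    by (intro arg_cong2[where f = "(\<and>)"] all_cong1 imp_cong refl) (simp_all only: im not_False_eq_True)
  also have "\<dots> \<longleftrightarrow> (\<forall>y. y \<noteq> 0 \<longrightarrow> coset K (\<sigma> y) = coset K y) \<and>
      (\<forall>y. y \<noteq> 0 \<longrightarrow> coset K (det T * \<sigma> y) = coset K y)"
  proof -
    have r: "rel_r K (coset K (\<sigma> y)) = rel_r K (coset K y) \<longleftrightarrow> coset K (\<sigma> y) = coset K y"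
      if "y \<noteq> 0" for y
    proof
      assume "rel_r K (coset K (\<sigma> y)) = rel_r K (coset K y)"
      with Galois_nonzero[OF \<sigma> that] show "coset K (\<sigma> y) = coset K y" by (rule rel_r_inj)
    qed (simp only:)
    have s: "rel_s K (coset K (det T * \<sigma> y)) = rel_s K (coset K y) \<longleftrightarrow> coset K (det T * \<sigma> y) = coset K y"
      if "y \<noteq> 0" for y
    proof
      assume eq: "rel_s K (coset K (det T * \<sigma> y)) = rel_s K (coset K y)"
      have "det T * \<sigma> y \<noteq> 0" using T Galois_nonzero[OF \<sigma> that] by simp
      from this eq show "coset K (det T * \<sigma> y) = coset K y" by (rule rel_s_inj)
    qed (simp only:)
    show ?thesis
      by (intro arg_cong2[where f = "(\<and>)"] all_cong1 imp_cong refl) (simp_all only: r s not_False_eq_True)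
  qed
  also have "\<dots> \<longleftrightarrow> det T \<in> K \<and> (\<forall>y. y \<noteq> 0 \<longrightarrow> coset K (\<sigma> y) = coset K y)"
  proof -
    have "coset K (det T * \<sigma> y) = coset K y \<longleftrightarrow> det T \<in> K" if "coset K (\<sigma> y) = coset K y" "y \<noteq> 0" for y
      using coset_det[OF Galois_nonzero[OF \<sigma> that(2)]] that(1) by simp
    note key = this
    show ?thesis
    proof (intro iffI conjI)
      assume eqs: "(\<forall>y. y \<noteq> 0 \<longrightarrow> coset K (\<sigma> y) = coset K y) \<and>
        (\<forall>y. y \<noteq> 0 \<longrightarrow> coset K (det T * \<sigma> y) = coset K y)"
      then have "coset K (\<sigma> 1) = coset K 1" "coset K (det T * \<sigma> 1) = coset K 1" by simp_all
      then show "det T \<in> K" using key[of 1] by simp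
      from eqs show "\<forall>y. y \<noteq> 0 \<longrightarrow> coset K (\<sigma> y) = coset K y" ..
    next
      assume eqs: "det T \<in> K \<and> (\<forall>y. y \<noteq> 0 \<longrightarrow> coset K (\<sigma> y) = coset K y)"
      then show "\<forall>y. y \<noteq> 0 \<longrightarrow> coset K (\<sigma> y) = coset K y" ..
      then show "\<forall>y. y \<noteq> 0 \<longrightarrow> coset K (det T * \<sigma> y) = coset K y" using key eqs by simp
    qed
  qed
  finally show ?thesis using x by (simp add: mem_GL2_K_Galois0_iff)
qed

end

theorem theorem3p6:
  fixes K :: "'a::{field,finite} set" and r d q n :: nat
  assumes "prime r" and "d \<ge> 1" and "q = r ^ d" and "CARD('a) = q"
    and "n dvd q - 1" and "even (q * (q - 1) div n)"
    and "subgroup K units_group" and "card (rcosets\<^bsub>units_group\<^esub> K) = n"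
    and "n \<ge> 3"
  shows "Aut (\<Omega> K) (S0 K) = induced K (GL2_K_Galois0 K) \<and>
         Iso (\<Omega> K) (S0 K) = induced K GammaL2"
proof -
  note K = \<open>subgroup K units_group\<close>
  have "card (rcosets\<^bsub>units_group\<^esub> K) * card K = order (units_group :: 'a monoid)"
    by (rule group.lagrange[OF group_units_group K])
  also have "\<dots> = CARD('a) - 1" by (simp add: order_def card_Diff_singleton)
  finally have n: "card K * n = CARD('a) - 1" "n \<ge> 2" using assms(8,9) by (simp_all add: mult.commute)
  have Iso: "Iso (\<Omega> K) (S0 K) = induced K GammaL2"
    using Iso_imp_gl_action[OF K n] gl_action_Iso[OF K] by (auto simp: induced_def)
  have "Aut (\<Omega> K) (S0 K) = induced K (GL2_K_Galois0 K)"
  proof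
    show "Aut (\<Omega> K) (S0 K) \<subseteq> induced K (GL2_K_Galois0 K)"
    proof
      fix f assume f: "f \<in> Aut (\<Omega> K) (S0 K)"
      then have "f \<in> Iso (\<Omega> K) (S0 K)" by (auto simp: Aut_def Iso_def)
      then obtain T \<sigma> where x: "(T, \<sigma>) \<in> carrier GammaL2" "f = gl_action K (T, \<sigma>)"
        using Iso_imp_gl_action[OF K n] by (metis surj_pair)
      then have "(T, \<sigma>) \<in> carrier (GL2_K_Galois0 K)" using f gl_action_Aut_iff[OF K x(1)] by simp
      then show "f \<in> induced K (GL2_K_Galois0 K)" unfolding induced_def x(2) by (rule imageI)
    qed
    show "induced K (GL2_K_Galois0 K) \<subseteq> Aut (\<Omega> K) (S0 K)"
    proof
      fix f assume "f \<in> induced K (GL2_K_Galois0 K)"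
      then obtain T \<sigma> where x: "(T, \<sigma>) \<in> carrier (GL2_K_Galois0 K)" "f = gl_action K (T, \<sigma>)"
        unfolding induced_def by (metis imageE surj_pair)
      then have "(T, \<sigma>) \<in> carrier GammaL2" using mem_GL2_K_Galois0_iff[OF K] by blast
      then show "f \<in> Aut (\<Omega> K) (S0 K)" unfolding x(2) using gl_action_Aut_iff[OF K] x(1) by blast
    qed
  qed
  then show ?thesis using Iso by blast
qed

end
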